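(* Let $d\ge2$. If at most $d$ candidates are ranked first (by some voter) in each round, then the replenished rule is a polynomial-time online rule such that, for every contiguous interval $I\subseteq T$ and every group $S$, the winner is the first choice of some member of $S$ in at least $\lfloor|I||S|/n\rfloor-(d-2)$ rounds of $I$. Consequently, it satisfies all-rank-PJR with additive loss $d-2$ on every interval. The rule is given neither $d$ nor the horizon. For two first choices ($d=2$) the loss is zero, and for three first choices ($d=3$) the loss of one is optimal: zero loss is impossible even for an offline rule and fixed-rank-wJR on a static one-dimensional Euclidean profile (that is, there is a static one-dimensional Euclidean profile with at most three first choices per round for which no sequence satisfies fixed-rank-wJR on every contiguous interval). For general $d$, the optimal worst-case additive loss for all-rank-PJR on intervals is $\Theta(d)$.
   Context: Model. Voters $V=[n]$, a set $C$ of $m$ candidates, rounds $T=\{1,\dots,|T|\}$ with $n,m,|T|\ge1$; $|T|$ is the horizon. In each round $j$ each voter $i$ has a strict complete ranking of $C$; her most-preferred candidate is her first choice. A profile is static if rankings are the same in all rounds, and one-dimensional Euclidean if, in each round, voters and candidates can be placed on the real line so that every voter ranks candidates by increasing distance, with no ties in distance. For $r\in[m]$, $A_i^j(r)$ is the set of voter $i$'s $r$ most-preferred candidates in round $j$; $N_c^j(1)$ is the set of voters whose first choice in round $j$ is $c$. A sequence is $W=(w^1,\dots,w^{|T|})\in C^{|T|}$. A group is a nonempty $S\subseteq V$. A rule is offline if it may use the whole profile; online if each $w^j$ depends only on rankings in rounds $1,\dots,j$ and not on $|T|$. Axioms on an interval. Let $I\subseteq T$ be a contiguous interval; agreement and representation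 are counted only in rounds of $I$, and $|I|$ plays the role of the horizon. All-rank-PJR with additive loss $L$ on $I$: for every choice of individual cutoffs $r_i^j\in[m]$ ($i\in V$, $j\in I$), every group $S$ for which $\bigcap_{i\in S}A_i^j(r_i^j)\ne\varnothing$ in $k>0$ rounds $j\in I$ has at least $\lfloor k|S|/n\rfloor-L$ rounds $j\in I$ with $w^j\in\bigcup_{i\in S}A_i^j(r_i^j)$. Fixed-rank-wJR on $I$: for every $r\in[m]$, every group $S$ with $|S|\ge n/|I|$ such that $\bigcap_{i\in S}A_i^j(r)\ne\varnothing$ for all $j\in I$ has a round $j\in I$ with $w^j\in\bigcup_{i\in S}A_i^j(r)$. One sequence must meet the requirement for all intervals simultaneously. The optimal worst-case loss on intervals for $d$ is the smallest integer $L$ such that some rule outputs, on every profile (any number of voters, candidates, any horizon) with at most $d$ first choices per round, a sequence satisfying all-rank-PJR with additive loss $L$ on every contiguous interval; the $\Theta(d)$ bound is asymptotic in $d$ and holds both for online and for offline rules. Replenished rule. All budgets $b_i$ start at $0$. At the beginning of each round $j$, each voter receives $1/n$ units. Then choose $w^j$ maximizing $\sum_{i\in N_c^j(1)}b_i$ over candidates $c$ with $N_c^j(1)\ne\varnothing$ (ties by a fixed candidate order), and deduct a total of $\min\{1,\sum_{i\in N_{w^j}^j(1)}b_i\}$ from voters in $N_{w^j}^j(1)$ in order of their indices, exhausting each budget before moving to the next voter. *)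

theory Defs
  imports Complex_Main "HOL-Library.Landau_Symbols"
begin

section \<open>Profiles\<close>

text \<open>
  Voters, candidates and rounds are numbered from 0: voters are \<open>i < n\<close>, candidates are
  \<open>c < m\<close>, rounds are \<open>j < length P\<close>, and \<open>length P\<close> is the horizon.  A ranking lists the
  candidates from best to worst; \<open>P ! j ! i\<close> is the ranking of voter \<open>i\<close> in round \<open>j\<close>.
  The numbering of the candidates is the fixed order used for breaking ties.
\<close>

type_synonym ranking = "nat list"
type_synonym round_profile = "ranking list"
type_synonym profile = "round_profile list"
type_synonym winners = "nat list"

definition profile :: "nat \<Rightarrow> nat \<Rightarrow> profile \<Rightarrow> bool" where
  "profile n m P \<longleftrightarrow> n \<ge> 1 \<and> m \<ge> 1 \<and> length P \<ge> 1 \<and>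
     (\<forall>j<length P. length (P ! j) = n \<and>
        (\<forall>i<n. distinct (P ! j ! i) \<and> set (P ! j ! i) = {..<m}))"

definition winner_seq :: "nat \<Rightarrow> profile \<Rightarrow> winners \<Rightarrow> bool" where
  "winner_seq m P W \<longleftrightarrow> length W = length P \<and> (\<forall>j<length P. W ! j < m)"

definition top :: "profile \<Rightarrow> nat \<Rightarrow> nat \<Rightarrow> nat \<Rightarrow> nat set" where
  "top P j i r = set (take r (P ! j ! i))"

definition first_choice :: "round_profile \<Rightarrow> nat \<Rightarrow> nat" where
  "first_choice R i = hd (R ! i)"

definition first_choices :: "round_profile \<Rightarrow> nat set" where
  "first_choices R = first_choice R ` {..<length R}"

definition supporters :: "round_profile \<Rightarrow> nat \<Rightarrow> nat set" where
  "supporters R c = {i. i < length R \<and> first_choice R i = c}"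

definition at_most_first_choices :: "nat \<Rightarrow> profile \<Rightarrow> bool" where
  "at_most_first_choices d P \<longleftrightarrow> (\<forall>j<length P. card (first_choices (P ! j)) \<le> d)"

definition static :: "profile \<Rightarrow> bool" where
  "static P \<longleftrightarrow> (\<forall>j<length P. P ! j = P ! 0)"

text \<open>
  As every ranking lists all candidates, strict sortedness by distance also says that no
  voter has two candidates at the same distance.
\<close>

definition euclidean_1d :: "profile \<Rightarrow> bool" where
  "euclidean_1d P \<longleftrightarrow> (\<forall>j<length P. \<exists>(x :: nat \<Rightarrow> real) (y :: nat \<Rightarrow> real).
     \<forall>i<length (P ! j). sorted_wrt (\<lambda>c c'. \<bar>x i - y c\<bar> < \<bar>x i - y c'\<bar>) (P ! j ! i))"

section \<open>Axioms on intervals\<close>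

definition intervals :: "nat \<Rightarrow> nat set set" where
  "intervals T = {{a..b} | a b. a \<le> b \<and> b < T}"

definition voter_group :: "nat \<Rightarrow> nat set \<Rightarrow> bool" where
  "voter_group n S \<longleftrightarrow> S \<noteq> {} \<and> S \<subseteq> {..<n}"

definition all_rank_PJR :: "nat \<Rightarrow> nat \<Rightarrow> profile \<Rightarrow> winners \<Rightarrow> int \<Rightarrow> nat set \<Rightarrow> bool" where
  "all_rank_PJR n m P W L I \<longleftrightarrow>
     (\<forall>r :: nat \<Rightarrow> nat \<Rightarrow> nat. (\<forall>i<n. \<forall>j\<in>I. r i j \<in> {1..m}) \<longrightarrow>
       (\<forall>S k. voter_group n S \<longrightarrow>
          k = card {j\<in>I. (\<Inter>i\<in>S. top P j i (r i j)) \<noteq> {}} \<longrightarrow> k > 0 \<longrightarrow>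
          int (card {j\<in>I. W ! j \<in> (\<Union>i\<in>S. top P j i (r i j))})
            \<ge> \<lfloor>real k * real (card S) / real n\<rfloor> - L))"

definition fixed_rank_wJR :: "nat \<Rightarrow> nat \<Rightarrow> profile \<Rightarrow> winners \<Rightarrow> nat set \<Rightarrow> bool" where
  "fixed_rank_wJR n m P W I \<longleftrightarrow>
     (\<forall>r\<in>{1..m}. \<forall>S. voter_group n S \<longrightarrow> real (card S) \<ge> real n / real (card I) \<longrightarrow>
        (\<forall>j\<in>I. (\<Inter>i\<in>S. top P j i r) \<noteq> {}) \<longrightarrow>
        (\<exists>j\<in>I. W ! j \<in> (\<Union>i\<in>S. top P j i r)))"

section \<open>Rules and optimal loss\<close>

type_synonym rule = "profile \<Rightarrow> winners"

definition offline :: "rule \<Rightarrow> bool" where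
  "offline F \<longleftrightarrow> (\<forall>n m P. profile n m P \<longrightarrow> winner_seq m P (F P))"

text \<open>
  The winner of round \<open>j\<close> is the same for any two profiles, of possibly different horizons,
  that agree up to and including round \<open>j\<close>.
\<close>

definition online :: "rule \<Rightarrow> bool" where
  "online F \<longleftrightarrow> offline F \<and>
     (\<forall>n m P Q j. profile n m P \<longrightarrow> profile n m Q \<longrightarrow> j < length P \<longrightarrow> j < length Q \<longrightarrow>
        take (Suc j) P = take (Suc j) Q \<longrightarrow> F P ! j = F Q ! j)"

definition achieves_interval_loss :: "nat \<Rightarrow> int \<Rightarrow> rule \<Rightarrow> bool" where
  "achieves_interval_loss d L F \<longleftrightarrow>
     (\<forall>n m P. profile n m P \<longrightarrow> at_most_first_choices d P \<longrightarrow>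
        (\<forall>I\<in>intervals (length P). all_rank_PJR n m P (F P) L I))"

text \<open>The argument \<open>kind\<close> is one of \<open>online\<close> and \<open>offline\<close>.\<close>

definition optimal_loss :: "(rule \<Rightarrow> bool) \<Rightarrow> nat \<Rightarrow> int \<Rightarrow> bool" where
  "optimal_loss kind d L \<longleftrightarrow>
     (\<exists>F. kind F \<and> achieves_interval_loss d L F) \<and>
     (\<forall>L'. (\<exists>F. kind F \<and> achieves_interval_loss d L' F) \<longrightarrow> L \<le> L')"

section \<open>The replenished rule\<close>

type_synonym budgets = "nat \<Rightarrow> real"

definition receive :: "nat \<Rightarrow> budgets \<Rightarrow> budgets" where
  "receive n b = (\<lambda>i. b i + 1 / real n)"

definition support_budget :: "budgets \<Rightarrow> round_profile \<Rightarrow> nat \<Rightarrow> real" where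
  "support_budget b R c = (\<Sum>i\<in>supporters R c. b i)"

definition choose_winner :: "budgets \<Rightarrow> round_profile \<Rightarrow> nat" where
  "choose_winner b R =
     (LEAST c. c \<in> first_choices R \<and>
        (\<forall>c'\<in>first_choices R. support_budget b R c' \<le> support_budget b R c))"

text \<open>\<open>deduct q xs b\<close> collects the amount \<open>q\<close> from the voters \<open>xs\<close>, in the order of the list.\<close>

fun deduct :: "real \<Rightarrow> nat list \<Rightarrow> budgets \<Rightarrow> budgets" where
  "deduct q [] b = b"
| "deduct q (i # xs) b = (let p = min q (b i) in deduct (q - p) xs (b(i := b i - p)))"

definition charge :: "budgets \<Rightarrow> round_profile \<Rightarrow> nat \<Rightarrow> budgets" where
  "charge b R w =
     deduct (min 1 (support_budget b R w)) (sorted_list_of_set (supporters R w)) b"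

fun replenished_from :: "budgets \<Rightarrow> rule" where
  "replenished_from b [] = []"
| "replenished_from b (R # P) =
     (let b' = receive (length R) b; w = choose_winner b' R
      in w # replenished_from (charge b' R w) P)"

definition replenished :: rule where
  "replenished = replenished_from (\<lambda>_. 0)"

section \<open>Polynomial time\<close>

text \<open>
  Structured programs for a random access machine whose memory consists of arrays of natural
  numbers.  The only arithmetic operations are addition and truncated subtraction; without
  multiplication, charging one unit per assignment and per test is polynomially equivalent to
  Turing machine time.  Expressions do not affect this, since a fixed program contains only
  finitely many of them.
\<close>

type_synonym memory = "nat \<Rightarrow> nat \<Rightarrow> nat"

datatype expr =
    Const nat
  | Read nat expr
  | Plus expr expr
  | Minus expr expr

fun val :: "expr \<Rightarrow> memory \<Rightarrow> nat" where
  "val (Const k) s = k"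
| "val (Read x e) s = s x (val e s)"
| "val (Plus e e') s = val e s + val e' s"
| "val (Minus e e') s = val e s - val e' s"

datatype com =
    Skip
  | Write nat expr expr
  | Seq com com
  | IfLess expr expr com com
  | WhileLess expr expr com

text \<open>
  \<open>run c s t s'\<close>: started in memory \<open>s\<close>, program \<open>c\<close> halts after \<open>t\<close> steps in memory \<open>s'\<close>.
  \<open>Write x e e'\<close> stores the value of \<open>e'\<close> in array \<open>x\<close> at the index given by \<open>e\<close>.
\<close>

inductive run :: "com \<Rightarrow> memory \<Rightarrow> nat \<Rightarrow> memory \<Rightarrow> bool" where
  skip: "run Skip s 1 s"
| assign: "run (Write x e e') s 1 (s(x := (s x)(val e s := val e' s)))"
| seq: "run c s t s' \<Longrightarrow> run c' s' t' s'' \<Longrightarrow> run (Seq c c') s (t + t') s''"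
| if_true: "val e s < val e' s \<Longrightarrow> run c s t s' \<Longrightarrow> run (IfLess e e' c c') s (t + 1) s'"
| if_false: "\<not> val e s < val e' s \<Longrightarrow> run c' s t s' \<Longrightarrow> run (IfLess e e' c c') s (t + 1) s'"
| while_false: "\<not> val e s < val e' s \<Longrightarrow> run (WhileLess e e' c) s 1 s"
| while_true: "val e s < val e' s \<Longrightarrow> run c s t s' \<Longrightarrow> run (WhileLess e e' c) s' t' s'' \<Longrightarrow>
    run (WhileLess e e' c) s (t + t' + 1) s''"

text \<open>
  Array 0 holds the numbers of voters, candidates and rounds, array 1 holds all rankings, one
  after another, and all other memory is 0.
\<close>

definition input_memory :: "nat \<Rightarrow> nat \<Rightarrow> profile \<Rightarrow> memory" where
  "input_memory n m P = (\<lambda>_ _. 0)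
     (0 := (\<lambda>_. 0)(0 := n, 1 := m, 2 := length P),
      1 := (\<lambda>a. if a < length P * n * m
                then P ! (a div (n * m)) ! (a div m mod n) ! (a mod m) else 0))"

text \<open>
  One program computes the winners of all rounds into array 2, in time polynomial in the number
  of entries of the input.  For an online rule, running it on the rounds up to \<open>j\<close> yields the
  winner of round \<open>j\<close> in time polynomial in what is known by then.
\<close>

definition polynomial_time :: "rule \<Rightarrow> bool" where
  "polynomial_time F \<longleftrightarrow>
     (\<exists>c k. \<forall>n m P. profile n m P \<longrightarrow>
        (\<exists>t s. run c (input_memory n m P) t s \<and>
           t \<le> k * (n * m * length P) ^ k \<and>
           (\<forall>j<length P. s 2 j = F P ! j)))"

end

theory Submission
  imports Defs
begin

text \<open>
  A group of voters receives \<open>1 / n\<close> per member in each round and pays at most 1 in each round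
  whose winner is the first choice of a member, so over an interval it can only miss out by what it
  still holds at the end.  This is less than \<open>d - 1\<close>: the total budget grows only in rounds where
  every first choice is supported by less than 1, and then at most \<open>d - 1\<close> unsuccessful first
  choices keep their money.

  Zero loss fails for three first choices because pinwheel scheduling with periods 2, 3, 6 is
  infeasible.  The linear lower bound comes from a Condorcet cycle of \<open>d\<close> voters over
  \<open>d div 2\<close> rounds, where at least half of the voters never see their first choice win.
\<close>

section \<open>The replenished rule\<close>

text \<open>Intervals need no separate treatment because the rule keeps no debts: a group enters any
  round with a nonnegative budget, so whatever happened earlier can only help it. The guarantee is
  uniform in \<open>d\<close> for a similar reason: \<open>d\<close> enters only the bound on the
  total budget, never the rule. Since that bound is strict, rounding down to integers gains one unit
  and turns \<open>d - 1\<close> into the loss \<open>d - 2\<close>. In the linear lower bound the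
  obstacle is that an offline rule knows the whole profile. It is overcome by the individual
  cutoffs, which are quantified after the winners: they may be chosen in reaction to the sequence,
  so a single static profile defeats every rule.\<close>

definition replenish_step :: "budgets \<Rightarrow> round_profile \<Rightarrow> budgets" where
  "replenish_step b R = (let b' = receive (length R) b in charge b' R (choose_winner b' R))"

text \<open>The state is taken before the payment of round \<open>j\<close>, so the step to
  \<open>Suc j\<close> contains exactly one payment and one charge, and the winner of round
  \<open>j\<close> is determined after applying \<open>receive\<close> to it.\<close>

definition budgets_at :: "profile \<Rightarrow> nat \<Rightarrow> budgets" where
  "budgets_at P j = foldl replenish_step (\<lambda>_. 0) (take j P)"

lemma budgets_at_0 [simp]: "budgets_at P 0 = (\<lambda>_. 0)"
  by (simp add: budgets_at_def)

lemma budgets_at_Suc: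
  "j < length P \<Longrightarrow> budgets_at P (Suc j) = replenish_step (budgets_at P j) (P ! j)"
  by (simp add: budgets_at_def take_Suc_conv_app_nth)

lemma replenished_from_nth:
  "j < length P \<Longrightarrow> replenished_from b P ! j =
     choose_winner (receive (length (P ! j)) (foldl replenish_step b (take j P))) (P ! j)"
proof (induction P arbitrary: b j)
  case (Cons R P)
  then show ?case
    by (cases j) (auto simp: Let_def replenish_step_def)
qed simp

lemma replenished_nth:
  "j < length P \<Longrightarrow>
     replenished P ! j = choose_winner (receive (length (P ! j)) (budgets_at P j)) (P ! j)"
  by (simp add: replenished_def replenished_from_nth budgets_at_def)

lemma length_replenished_from [simp]: "length (replenished_from b P) = length P"
  by (induction P arbitrary: b) (auto simp: Let_def)

text \<open>Later rounds never influence earlier winners; the online property follows from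
  this.\<close>

lemma take_replenished_from:
  "take k (replenished_from b P) = replenished_from b (take k P)"
proof (induction P arbitrary: b k)
  case (Cons R P)
  then show ?case by (cases k) (auto simp: Let_def)
qed simp

lemma finite_supporters [simp]: "finite (supporters R c)"
  by (simp add: supporters_def)

lemma finite_first_choices [simp]: "finite (first_choices R)"
  by (simp add: first_choices_def)

lemma choose_winner_maximal:
  assumes "R \<noteq> []"
  shows "choose_winner b R \<in> first_choices R"
    and "c \<in> first_choices R \<Longrightarrow> support_budget b R c \<le> support_budget b R (choose_winner b R)"
proof -
  let ?M = "support_budget b R ` first_choices R"
  have ne: "first_choices R \<noteq> {}"
    using assms by (simp add: first_choices_def lessThan_empty_iff)
  then have "Max ?M \<in> ?M" by (intro Max_in) auto
  then obtain c0 where "c0 \<in> first_choices R" "support_budget b R c0 = Max ?M" by force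
  then have "c0 \<in> first_choices R \<and>
      (\<forall>c'\<in>first_choices R. support_budget b R c' \<le> support_budget b R c0)"
    by simp
  from LeastI[where P = "\<lambda>c. c \<in> first_choices R \<and>
      (\<forall>c'\<in>first_choices R. support_budget b R c' \<le> support_budget b R c)", OF this]
  show "choose_winner b R \<in> first_choices R"
    "c \<in> first_choices R \<Longrightarrow> support_budget b R c \<le> support_budget b R (choose_winner b R)"
    unfolding choose_winner_def by auto
qed

section \<open>Accounting for a single round\<close>

lemma deduct_outside: "i \<notin> set xs \<Longrightarrow> deduct q xs b i = b i"
  by (induction xs arbitrary: q b) (auto simp: Let_def)

lemma deduct_bounds:
  assumes "0 \<le> q" "\<forall>i. 0 \<le> b i"
  shows "0 \<le> deduct q xs b i \<and> deduct q xs b i \<le> b i"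
  using assms
proof (induction xs arbitrary: q b)
  case (Cons x xs)
  let ?p = "min q (b x)"
  have "0 \<le> deduct (q - ?p) xs (b(x := b x - ?p)) i \<and>
      deduct (q - ?p) xs (b(x := b x - ?p)) i \<le> (b(x := b x - ?p)) i"
    using Cons.prems by (intro Cons.IH) auto
  moreover have "(b(x := b x - ?p)) i \<le> b i"
    using Cons.prems by auto
  ultimately show ?case by (auto simp: Let_def intro: order_trans)
qed simp

text \<open>Each voter either covers all that is still due or is exhausted, so less than
  \<open>q\<close> is collected only if everyone is exhausted. Distinctness ensures that a voter who
  has paid is not visited again.\<close>

lemma sum_deduct:
  assumes "distinct xs" "0 \<le> q" "\<forall>i. 0 \<le> b i"
  shows "sum (deduct q xs b) (set xs) = sum b (set xs) - min q (sum b (set xs))"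
  using assms
proof (induction xs arbitrary: q b)
  case (Cons x xs)
  let ?p = "min q (b x)"
  let ?b = "b(x := b x - ?p)"
  have "sum (deduct (q - ?p) xs ?b) (set xs) =
      sum ?b (set xs) - min (q - ?p) (sum ?b (set xs))"
    using Cons.prems by (intro Cons.IH) auto
  moreover have "sum ?b (set xs) = sum b (set xs)"
    using Cons.prems by (intro sum.cong) auto
  moreover have "deduct (q - ?p) xs ?b x = b x - ?p"
    using Cons.prems by (simp add: deduct_outside)
  moreover have "0 \<le> sum b (set xs)"
    using Cons.prems by (simp add: sum_nonneg)
  ultimately show ?case
    using Cons.prems by (auto simp: Let_def min_def)
qed simp

lemma charge_bounds:
  assumes "\<forall>i. 0 \<le> b i"
  shows "0 \<le> charge b R w i" "charge b R w i \<le> b i"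
    "i \<notin> supporters R w \<Longrightarrow> charge b R w i = b i"
  using deduct_bounds[of "min 1 (support_budget b R w)" b] assms
  by (auto simp: charge_def support_budget_def sum_nonneg deduct_outside)

lemma sum_charge_supporters:
  assumes "\<forall>i. 0 \<le> b i"
  shows "(\<Sum>i\<in>supporters R w. charge b R w i) =
    support_budget b R w - min 1 (support_budget b R w)"
  using sum_deduct[of "sorted_list_of_set (supporters R w)" "min 1 (support_budget b R w)" b] assms
  by (simp add: charge_def support_budget_def sum_nonneg)

text \<open>What the members of \<open>S\<close> pay is part of what all supporters of
  \<open>w\<close> pay, which is at most 1; members who do not support \<open>w\<close> pay
  nothing.\<close>

lemma sum_charge:
  assumes "\<forall>i. 0 \<le> b i" and "finite S"
  shows "sum b S - (if S \<inter> supporters R w = {} then 0 else 1) \<le> sum (charge b R w) S"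
proof (cases "S \<inter> supporters R w = {}")
  case True
  then have "sum (charge b R w) S = sum b S"
    using assms by (intro sum.cong) (auto intro!: charge_bounds(3))
  then show ?thesis using True by simp
next
  case False
  have "(\<Sum>i\<in>S. b i - charge b R w i) = (\<Sum>i\<in>S \<inter> supporters R w. b i - charge b R w i)"
    using assms by (intro sum.mono_neutral_right) (auto simp: charge_bounds(3))
  also have "\<dots> \<le> (\<Sum>i\<in>supporters R w. b i - charge b R w i)"
    using assms by (intro sum_mono2) (auto simp: charge_bounds(2))
  also have "\<dots> \<le> 1"
    using sum_charge_supporters[OF assms(1), of R w]
    by (simp add: sum_subtractf support_budget_def)
  finally show ?thesis using False by (simp add: sum_subtractf)
qed

text \<open>Every voter has exactly one first choice, so the sets of supporters partition the
  voters.\<close>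

lemma sum_support_budget:
  "(\<Sum>c\<in>first_choices R. support_budget b R c) = (\<Sum>i<length R. b i)"
  using sum.image_gen[of "{..<length R}" b "first_choice R"]
  by (simp add: first_choices_def support_budget_def supporters_def)

text \<open>If the winner is charged less than 1, then so would have been every other first choice, and
  what remains is held by the supporters of at most \<open>d - 1\<close> candidates.\<close>

lemma total_budget_step:
  assumes "\<forall>i. 0 \<le> b i" and "R \<noteq> []" and "card (first_choices R) \<le> d" and "d \<ge> 2"
    and "(\<Sum>i<length R. b i) < real d - 1"
  shows "(\<Sum>i<length R. replenish_step b R i) < real d - 1"
proof -
  define b' where "b' = receive (length R) b"
  define w where "w = choose_winner b' R"
  let ?B = "support_budget b' R"
  have b': "\<forall>i. 0 \<le> b' i" using assms(1) by (simp add: b'_def receive_def)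
  have w: "w \<in> first_choices R" "\<And>c. c \<in> first_choices R \<Longrightarrow> ?B c \<le> ?B w"
    using choose_winner_maximal[OF assms(2)] by (auto simp: w_def)
  have step: "replenish_step b R = charge b' R w"
    by (simp add: replenish_step_def b'_def w_def Let_def)
  have sub: "supporters R w \<subseteq> {..<length R}" by (auto simp: supporters_def)
  have "(\<Sum>i<length R. b' i - charge b' R w i) =
      (\<Sum>i\<in>supporters R w. b' i - charge b' R w i)"
    using sub b' by (intro sum.mono_neutral_right) (auto simp: charge_bounds(3))
  also have "\<dots> = min 1 (?B w)"
    using sum_charge_supporters[OF b', of R w]
    by (simp add: sum_subtractf support_budget_def)
  finally have total: "(\<Sum>i<length R. charge b' R w i) = (\<Sum>i<length R. b' i) - min 1 (?B w)"
    by (simp add: sum_subtractf)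
  have inc: "(\<Sum>i<length R. b' i) = (\<Sum>i<length R. b i) + 1"
    using assms(2) by (simp add: b'_def receive_def sum.distrib)
  show ?thesis
  \<comment> \<open>If the winner can pay in full, the charge of 1 cancels the \<open>n\<close>
    payments of \<open>1 / n\<close>. Otherwise all supporters of the winner are exhausted.\<close>
  proof (cases "?B w \<ge> 1")
    case True
    then show ?thesis using total inc assms(5) by (simp add: step)
  next
    case False
    have "(\<Sum>i<length R. b' i) - ?B w = (\<Sum>c\<in>first_choices R - {w}. ?B c)"
      using w(1) by (simp add: sum_support_budget[symmetric] sum_diff1)
    also have "\<dots> < real d - 1"
    \<comment> \<open>The strict comparison of sums requires another first choice; a sole first
      choice leaves budget 0, which is below \<open>d - 1\<close> because
      \<open>d >= 2\<close>.\<close>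
    proof (cases "first_choices R - {w} = {}")
      case True
      show ?thesis unfolding True using assms(4) by simp
    next
      case nonempty: False
      have "?B c < 1" if "c \<in> first_choices R" for c
        using w(2)[OF that] False by simp
      then have "(\<Sum>c\<in>first_choices R - {w}. ?B c) < (\<Sum>c\<in>first_choices R - {w}. 1)"
        using nonempty by (intro sum_strict_mono) simp_all
      also have "\<dots> \<le> real d - 1"
      proof -
        have "card (first_choices R) \<ge> 1"
          using w(1) by (metis card_0_eq empty_iff finite_first_choices less_one not_le)
        then show ?thesis using w(1) assms(3,4) by (simp add: card_Diff_singleton of_nat_diff)
      qed
      finally show ?thesis .
    qed
    finally show ?thesis using total False by (simp add: step)
  qed
qed

section \<open>Budgets over many rounds\<close>

lemma replenish_step_nonneg: "\<forall>i. 0 \<le> b i \<Longrightarrow> 0 \<le> replenish_step b R i"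
  by (simp add: replenish_step_def receive_def charge_bounds(1) Let_def)

lemma budgets_at_nonneg: "j \<le> length P \<Longrightarrow> 0 \<le> budgets_at P j i"
  by (induction j arbitrary: i) (auto simp: budgets_at_Suc replenish_step_nonneg)

lemma profileD:
  assumes "profile n m P" "j < length P"
  shows "length (P ! j) = n" "P ! j \<noteq> []" "i < n \<Longrightarrow> distinct (P ! j ! i)"
    "i < n \<Longrightarrow> set (P ! j ! i) = {..<m}" "n \<ge> 1" "m \<ge> 1"
  using assms by (auto simp: profile_def)

lemma length_ranking:
  "profile n m P \<Longrightarrow> j < length P \<Longrightarrow> i < n \<Longrightarrow> length (P ! j ! i) = m"
  using profileD(3,4) by (metis card_lessThan distinct_card)

lemma first_choice_less:
  assumes "profile n m P" "j < length P" "i < n"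
  shows "first_choice (P ! j) i < m"
proof -
  have "P ! j ! i \<noteq> []" using length_ranking[OF assms] profileD(6)[OF assms(1,2)] by auto
  then have "hd (P ! j ! i) \<in> set (P ! j ! i)" by simp
  then show ?thesis using profileD(4)[OF assms] by (simp add: first_choice_def)
qed

lemma total_budget_less:
  assumes "profile n m P" "at_most_first_choices d P" "d \<ge> 2"
  shows "j \<le> length P \<Longrightarrow> (\<Sum>i<n. budgets_at P j i) < real d - 1"
proof (induction j)
  case 0
  then show ?case using assms(3) by simp
next
  case (Suc j)
  then have j: "j < length P" by simp
  show ?case
    using total_budget_step[of "budgets_at P j" "P ! j" d] Suc assms
    by (simp add: budgets_at_Suc j budgets_at_nonneg profileD[OF assms(1) j] at_most_first_choices_def)
qed

lemma group_budget_step: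
  assumes "profile n m P" "j < length P" "S \<subseteq> {..<n}"
  shows "sum (budgets_at P j) S + real (card S) / real n
      - (if \<exists>i\<in>S. first_choice (P ! j) i = replenished P ! j then 1 else 0)
    \<le> sum (budgets_at P (Suc j)) S"
proof -
  define b where "b = receive n (budgets_at P j)"
  have fin: "finite S" using assms(3) by (rule finite_subset) simp
  have b: "\<forall>i. 0 \<le> b i"
    using assms(2) by (simp add: b_def receive_def budgets_at_nonneg)
  have eq: "budgets_at P (Suc j) = charge b (P ! j) (replenished P ! j)"
    using assms by (simp add: budgets_at_Suc replenish_step_def Let_def b_def profileD replenished_nth)
  have "sum b S = sum (budgets_at P j) S + real (card S) / real n"
    by (simp add: b_def receive_def sum.distrib)
  moreover have "S \<inter> supporters (P ! j) (replenished P ! j) = {} \<longleftrightarrow>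
      \<not> (\<exists>i\<in>S. first_choice (P ! j) i = replenished P ! j)"
    using assms by (auto simp: supporters_def profileD)
  ultimately show ?thesis
    using sum_charge[OF b fin, of "P ! j" "replenished P ! j"] by (auto simp: eq split: if_splits)
qed

text \<open>Summing the single steps would give the budget at \<open>a\<close> as a further term on
  the left; it is nonnegative and is dropped in the base case.\<close>

lemma group_budget_interval:
  assumes "profile n m P" "S \<subseteq> {..<n}"
  shows "a + l \<le> length P \<Longrightarrow>
    real l * real (card S) / real n
      - real (card {j\<in>{a..<a + l}. \<exists>i\<in>S. first_choice (P ! j) i = replenished P ! j})
    \<le> sum (budgets_at P (a + l)) S"
proof (induction l)
  case 0
  then show ?case by (simp add: sum_nonneg budgets_at_nonneg)
next
  case (Suc l)
  let ?Q = "\<lambda>j. \<exists>i\<in>S. first_choice (P ! j) i = replenished P ! j"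
  have "{j\<in>{a..<a + Suc l}. ?Q j} =
      (if ?Q (a + l) then insert (a + l) {j\<in>{a..<a + l}. ?Q j} else {j\<in>{a..<a + l}. ?Q j})"
    by (auto simp: less_Suc_eq)
  then have "real (card {j\<in>{a..<a + Suc l}. ?Q j}) =
      real (card {j\<in>{a..<a + l}. ?Q j}) + (if ?Q (a + l) then 1 else 0)"
    by (simp del: ex_simps)
  moreover have "real (Suc l) * real (card S) / real n =
      real l * real (card S) / real n + real (card S) / real n"
    by (simp add: algebra_simps add_divide_distrib)
  moreover note Suc group_budget_step[OF assms(1) _ assms(2), of "a + l"]
  ultimately show ?case by simp
qed

lemma replenished_first_choice_bound:
  assumes "profile n m P" "at_most_first_choices d P" "d \<ge> 2"
    and "I \<in> intervals (length P)" "voter_group n S"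
  shows "int (card {j\<in>I. \<exists>i\<in>S. first_choice (P ! j) i = replenished P ! j})
    \<ge> \<lfloor>real (card I) * real (card S) / real n\<rfloor> - (int d - 2)"
proof -
  obtain a b where I: "I = {a..b}" "a \<le> b" "b < length P"
    using assms(4) by (auto simp: intervals_def)
  define l where "l = Suc b - a"
  have l: "I = {a..<a + l}" "card I = l" "a + l \<le> length P"
    using I by (auto simp: l_def)
  have S: "S \<subseteq> {..<n}" using assms(5) by (simp add: voter_group_def)
  let ?wins = "card {j\<in>I. \<exists>i\<in>S. first_choice (P ! j) i = replenished P ! j}"
  have "real l * real (card S) / real n - real ?wins \<le> sum (budgets_at P (a + l)) S"
    using group_budget_interval[OF assms(1) S l(3)] by (simp add: l(1))
  also have "\<dots> \<le> (\<Sum>i<n. budgets_at P (a + l) i)"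
    using S l(3) by (intro sum_mono2) (auto simp: budgets_at_nonneg)
  also have "\<dots> < real d - 1"
    using total_budget_less[OF assms(1-3)] l(3) by simp
  finally have "real (card I) * real (card S) / real n < real_of_int (int ?wins + int d - 1)"
    by (simp add: l(2))
  then have "\<lfloor>real (card I) * real (card S) / real n\<rfloor> < int ?wins + int d - 1"
    by (simp only: floor_less_iff)
  then show ?thesis by simp
qed

lemma first_choice_in_top:
  assumes "profile n m P" "j < length P" "i < n" "r \<ge> 1"
  shows "first_choice (P ! j) i \<in> top P j i r"
proof -
  have "P ! j ! i \<noteq> []" using length_ranking[OF assms(1-3)] profileD(6)[OF assms(1,2)] by auto
  then show ?thesis
    using assms(4) by (cases "P ! j ! i"; cases r) (auto simp: first_choice_def top_def)
qed

text \<open>All cutoffs are at least 1, so a win of a member's first choice always counts as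
  representation, and the rounds of agreement are at most \<open>card I\<close> in number. The bound
  for first choices therefore covers every choice of cutoffs.\<close>

lemma replenished_achieves:
  assumes "d \<ge> 2"
  shows "achieves_interval_loss d (int d - 2) replenished"
  unfolding achieves_interval_loss_def all_rank_PJR_def
proof (intro allI impI ballI)
  fix n m P I r S k
  assume P: "profile n m P" "at_most_first_choices d P" and I: "I \<in> intervals (length P)"
    and r: "\<forall>i<n. \<forall>j\<in>I. r i j \<in> {1..m}" and S: "voter_group n S"
    and k: "k = card {j\<in>I. (\<Inter>i\<in>S. top P j i (r i j)) \<noteq> {}}"
  have I': "finite I" "\<And>j. j \<in> I \<Longrightarrow> j < length P" using I by (auto simp: intervals_def)
  have "k \<le> card I" unfolding k using I' by (intro card_mono) auto
  then have "real k * real (card S) / real n \<le> real (card I) * real (card S) / real n"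
    by (intro divide_right_mono mult_right_mono) auto
  then have "\<lfloor>real k * real (card S) / real n\<rfloor> - (int d - 2)
      \<le> \<lfloor>real (card I) * real (card S) / real n\<rfloor> - (int d - 2)"
    by (simp add: floor_mono)
  also have "\<dots> \<le> int (card {j\<in>I. \<exists>i\<in>S. first_choice (P ! j) i = replenished P ! j})"
    using replenished_first_choice_bound[OF P assms I S] .
  also have "\<dots> \<le> int (card {j\<in>I. replenished P ! j \<in> (\<Union>i\<in>S. top P j i (r i j))})"
  proof -
    have "first_choice (P ! j) i \<in> top P j i (r i j)" if "j \<in> I" "i \<in> S" for i j
      using that S r I' P(1) by (intro first_choice_in_top[of n m]) (auto simp: voter_group_def)
    then have "{j\<in>I. \<exists>i\<in>S. first_choice (P ! j) i = replenished P ! j}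
        \<subseteq> {j\<in>I. replenished P ! j \<in> (\<Union>i\<in>S. top P j i (r i j))}"
      by force
    then show ?thesis using I' by (simp add: card_mono)
  qed
  finally show "\<lfloor>real k * real (card S) / real n\<rfloor> - (int d - 2)
      \<le> int (card {j\<in>I. replenished P ! j \<in> (\<Union>i\<in>S. top P j i (r i j))})" .
qed

lemma online_replenished: "online replenished"
  unfolding online_def offline_def
proof (intro conjI allI impI)
  fix n m P assume P: "profile n m P"
  have "replenished P ! j < m" if "j < length P" for j
  proof -
    have "replenished P ! j \<in> first_choices (P ! j)"
      using that P by (simp add: replenished_nth choose_winner_maximal(1) profileD)
    then show ?thesis
      using first_choice_less[OF P that] profileD(1)[OF P that] by (auto simp: first_choices_def)
  qed
  then show "winner_seq m P (replenished P)"
    by (simp add: winner_seq_def replenished_def)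
next
  fix n m j and P Q :: profile
  assume "j < length P" "j < length Q" "take (Suc j) P = take (Suc j) Q"
  then have "take (Suc j) (replenished P) = take (Suc j) (replenished Q)"
    by (simp add: replenished_def take_replenished_from)
  then show "replenished P ! j = replenished Q ! j"
    by (metis lessI nth_take)
qed

section \<open>A program for the replenished rule\<close>

text \<open>A total-correctness triple for one start memory. The time is only bounded from above, so
  that branches of different cost can share a bound.\<close>

definition runs_to :: "com \<Rightarrow> nat \<Rightarrow> memory \<Rightarrow> (memory \<Rightarrow> bool) \<Rightarrow> bool" where
  "runs_to c t s Q \<longleftrightarrow> (\<exists>t' s'. run c s t' s' \<and> t' \<le> t \<and> Q s')"

lemma runs_to_mono:
  "runs_to c t s Q \<Longrightarrow> t \<le> t' \<Longrightarrow> (\<And>s'. Q s' \<Longrightarrow> Q' s') \<Longrightarrow> runs_to c t' s Q'"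
  unfolding runs_to_def by (meson order_trans)

lemma runs_to_Skip: "Q s \<Longrightarrow> runs_to Skip (Suc t) s Q"
  unfolding runs_to_def by (rule exI[of _ 1]) (auto intro: run.skip[unfolded One_nat_def])

lemma runs_to_Write:
  "Q (s(x := (s x)(val e s := val e' s))) \<Longrightarrow> runs_to (Write x e e') (Suc t) s Q"
  unfolding runs_to_def by (rule exI[of _ 1]) (auto intro: run.assign[unfolded One_nat_def])

lemma runs_to_Seq:
  "runs_to c t s (\<lambda>s'. runs_to c' t' s' Q) \<Longrightarrow> runs_to (Seq c c') (t + t') s Q"
  unfolding runs_to_def by (meson add_mono run.seq)

lemma runs_to_Write_Seq:
  assumes "runs_to c t (s(x := (s x)(val e s := val e' s))) Q"
  shows "runs_to (Seq (Write x e e') c) (Suc t) s Q"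
proof -
  have "runs_to (Write x e e') (Suc 0) s (\<lambda>s'. runs_to c t s' Q)"
    using assms by (rule runs_to_Write)
  from runs_to_Seq[OF this] show ?thesis by simp
qed

lemma runs_to_IfLess:
  assumes "val e s < val e' s \<Longrightarrow> runs_to c t s Q" "\<not> val e s < val e' s \<Longrightarrow> runs_to c' t s Q"
  shows "runs_to (IfLess e e' c c') (Suc t) s Q"
  using assms unfolding runs_to_def
  by (metis Suc_eq_plus1 Suc_le_mono run.if_true run.if_false)

abbreviation var :: "nat \<Rightarrow> expr" where
  "var x \<equiv> Read x (Const 0)"

definition for_loop :: "nat \<Rightarrow> expr \<Rightarrow> com \<Rightarrow> com" where
  "for_loop x e c = Seq (Write x (Const 0) (Const 0))
     (WhileLess (var x) e (Seq c (Write x (Const 0) (Plus (var x) (Const 1)))))"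

text \<open>Each iteration pays 2 beyond its body, for the increment and the successful test; the
  last unit is the failing test. The invariant speaks of the loop head, hence the incremented
  counter in \<open>step\<close>, and it must determine both the counter and the limit.\<close>

lemma runs_to_while:
  assumes bound: "\<And>k s. Inv k s \<Longrightarrow> s x 0 = k \<and> val e s = N"
    and step: "\<And>k s. k < N \<Longrightarrow> Inv k s \<Longrightarrow>
      runs_to c t s (\<lambda>s'. Inv (Suc k) (s'(x := (s' x)(0 := Suc (s' x 0)))))"
  shows "k \<le> N \<Longrightarrow> Inv k s \<Longrightarrow>
    runs_to (WhileLess (var x) e (Seq c (Write x (Const 0) (Plus (var x) (Const 1)))))
      ((N - k) * (t + 2) + 1) s (Inv N)"
proof (induction "N - k" arbitrary: k s)
  case 0
  let ?c = "Seq c (Write x (Const 0) (Plus (var x) (Const 1)))"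
  have "run (WhileLess (var x) e ?c) s 1 s"
    using bound[OF 0(3)] 0 by (intro run.while_false) auto
  moreover have "Inv N s" using 0 by simp
  ultimately show ?case unfolding runs_to_def by (metis le_add2)
next
  case (Suc l)
  let ?c = "Seq c (Write x (Const 0) (Plus (var x) (Const 1)))"
  have k: "k < N" "l = N - Suc k" using Suc.hyps(2) by auto
  obtain t1 s1 where 1: "run c s t1 s1" "t1 \<le> t"
      "Inv (Suc k) (s1(x := (s1 x)(0 := Suc (s1 x 0))))" (is "Inv _ ?s2")
    using step[OF k(1) Suc.prems(2)] by (auto simp: runs_to_def)
  have "run (Write x (Const 0) (Plus (var x) (Const 1))) s1 1 ?s2"
    using run.assign[of x "Const 0" "Plus (var x) (Const 1)" s1] by simp
  with 1(1) have body: "run ?c s (t1 + 1) ?s2" by (rule run.seq)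
  obtain t3 s3 where 3: "run (WhileLess (var x) e ?c) ?s2 t3 s3"
      "t3 \<le> (N - Suc k) * (t + 2) + 1" "Inv N s3"
    using Suc.hyps(1)[OF k(2) _ 1(3)] k(1) by (auto simp: runs_to_def)
  have "val (var x) s < val e s" using bound[OF Suc.prems(2)] k(1) by simp
  then have "run (WhileLess (var x) e ?c) s (t1 + 1 + t3 + 1) s3"
    using body 3(1) by (rule run.while_true)
  moreover have "t1 + 1 + t3 + 1 \<le> (N - k) * (t + 2) + 1"
    using 1(2) 3(2) by (simp add: Suc.hyps(2)[symmetric] k(2)[symmetric])
  ultimately show ?case using 3(3) unfolding runs_to_def by blast
qed

lemma runs_to_for_loop:
  assumes "Inv 0 (s(x := (s x)(0 := 0)))"
    and "\<And>k s. Inv k s \<Longrightarrow> s x 0 = k \<and> val e s = N"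
    and "\<And>k s. k < N \<Longrightarrow> Inv k s \<Longrightarrow>
      runs_to c t s (\<lambda>s'. Inv (Suc k) (s'(x := (s' x)(0 := Suc (s' x 0)))))"
    and "\<And>s'. Inv N s' \<Longrightarrow> Q s'"
  shows "runs_to (for_loop x e c) (N * (t + 2) + 2) s Q"
proof -
  have "runs_to (WhileLess (var x) e (Seq c (Write x (Const 0) (Plus (var x) (Const 1)))))
      (N * (t + 2) + 1) (s(x := (s x)(0 := 0))) Q"
    using runs_to_while[of Inv x e N c t 0, OF assms(2,3) _ assms(1)] assms(4)
    by (auto elim: runs_to_mono)
  then show ?thesis
    unfolding for_loop_def by (auto intro: runs_to_Write_Seq)
qed

text \<open>The frame condition of a program fragment, at the granularity of whole arrays rather
  than cells.\<close>

definition same_except :: "nat set \<Rightarrow> memory \<Rightarrow> memory \<Rightarrow> bool" where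
  "same_except A s s' \<longleftrightarrow> (\<forall>y. y \<notin> A \<longrightarrow> s' y = s y)"

text \<open>
  Budgets are stored in units of \<open>1 / n\<close>, which makes them integers.  Array 3 holds the budgets,
  array 4 the support of each candidate, array 11 the first choices of the current round.  Cell 0
  of the arrays 5 to 10 holds, in this order, the round, the position in the input, the loop
  counter, the winner, the amount still to be deducted and an auxiliary value.
\<close>

definition clear_prog :: com where
  "clear_prog = for_loop 7 (Read 0 (Const 1)) (Write 4 (var 7) (Const 0))"

text \<open>The machine cannot multiply, so the reading position is advanced by the number of
  candidates after each voter instead of being computed from round and voter.\<close>

definition support_prog :: com where
  "support_prog = for_loop 7 (Read 0 (Const 0))
     (Seq (Write 11 (var 7) (Read 1 (var 6)))
     (Seq (Write 3 (var 7) (Plus (Read 3 (var 7)) (Const 1)))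
     (Seq (Write 4 (Read 11 (var 7)) (Plus (Read 4 (Read 11 (var 7))) (Read 3 (var 7))))
          (Write 6 (Const 0) (Plus (var 6) (Read 0 (Const 1)))))))"

text \<open>The strict test keeps the earlier of two tied candidates, in accordance with the
  \<open>LEAST\<close> in \<open>choose_winner\<close>.\<close>

definition winner_prog :: com where
  "winner_prog = Seq (Write 8 (Const 0) (Const 0))
     (for_loop 7 (Read 0 (Const 1))
       (IfLess (Read 4 (var 8)) (Read 4 (var 7)) (Write 8 (Const 0) (var 7)) Skip))"

text \<open>Two strict comparisons replace the missing equality test. With payment
  \<open>min q b\<close>, the new budget is the truncated \<open>b - q\<close> and the new amount
  due is the truncated \<open>q - b\<close>; the latter needs the old \<open>b\<close>, which is
  saved in array 10.\<close>

definition deduct_prog :: com where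
  "deduct_prog = for_loop 7 (Read 0 (Const 0))
     (IfLess (Read 11 (var 7)) (var 8) Skip
     (IfLess (var 8) (Read 11 (var 7)) Skip
       (Seq (Write 10 (Const 0) (Read 3 (var 7)))
       (Seq (Write 3 (var 7) (Minus (Read 3 (var 7)) (var 9)))
            (Write 9 (Const 0) (Minus (var 9) (var 10)))))))"

text \<open>With truncated subtraction, \<open>x - (x - n)\<close> is the minimum of
  \<open>x\<close> and \<open>n\<close>, and \<open>n\<close> units are a budget of 1.\<close>

definition charge_prog :: com where
  "charge_prog = Seq
     (Write 9 (Const 0) (Minus (Read 4 (var 8)) (Minus (Read 4 (var 8)) (Read 0 (Const 0)))))
     deduct_prog"

definition round_prog :: com where
  "round_prog = Seq clear_prog (Seq support_prog (Seq winner_prog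
     (Seq (Write 2 (var 5) (var 8)) charge_prog)))"

definition replenished_prog :: com where
  "replenished_prog = for_loop 5 (Read 0 (Const 2)) round_prog"

section \<open>Correctness and running time of the program\<close>

lemma runs_to_clear_prog:
  assumes "s 0 1 = m"
  shows "runs_to clear_prog (m * 3 + 2) s
    (\<lambda>s'. same_except {4, 7} s s' \<and> (\<forall>c<m. s' 4 c = 0))"
proof -
  let ?Inv = "\<lambda>k s'. same_except {4, 7} s s' \<and> s' 7 0 = k \<and> (\<forall>c<k. s' 4 c = 0)"
  \<comment> \<open>The bound of the loop body is kept in successor form, to which the rules for
    single statements apply.\<close>
  have "runs_to clear_prog (m * (Suc 0 + 2) + 2) s
    (\<lambda>s'. same_except {4, 7} s s' \<and> (\<forall>c<m. s' 4 c = 0))"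
    unfolding clear_prog_def
  proof (rule runs_to_for_loop[where Inv = ?Inv])
    fix k s'
    assume "?Inv k s'"
    then show "runs_to (Write 4 (var 7) (Const 0)) (Suc 0) s'
        (\<lambda>s'. ?Inv (Suc k) (s'(7 := (s' 7)(0 := Suc (s' 7 0)))))"
      by (intro runs_to_Write) (auto simp: same_except_def less_Suc_eq)
  qed (use assms in \<open>auto simp: same_except_def\<close>)
  then show ?thesis by (simp add: numeral_eq_Suc)
qed

lemma runs_to_support_prog:
  assumes "s 0 0 = n" "s 0 1 = m" "\<forall>c<m. s 4 c = 0"
    and "\<forall>i<n. s 1 (s 6 0 + i * m) = f i" "\<forall>i<n. f i < m"
  shows "runs_to support_prog (n * 6 + 2) s
    (\<lambda>s'. same_except {3, 4, 6, 7, 11} s s' \<and> s' 6 0 = s 6 0 + n * m \<and>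
       (\<forall>i<n. s' 3 i = s 3 i + 1) \<and> (\<forall>i<n. s' 11 i = f i) \<and>
       (\<forall>c<m. s' 4 c = (\<Sum>i<n. if f i = c then s 3 i + 1 else 0)))"
proof -
  \<comment> \<open>Array 3 is described also for voters not yet reached, whose old budgets the
    later iterations will read.\<close>
  let ?Inv = "\<lambda>k s'. same_except {3, 4, 6, 7, 11} s s' \<and> s' 7 0 = k \<and> s' 6 0 = s 6 0 + k * m \<and>
       (\<forall>i. s' 3 i = (if i < k then s 3 i + 1 else s 3 i)) \<and> (\<forall>i<k. s' 11 i = f i) \<and>
       (\<forall>c<m. s' 4 c = (\<Sum>i<k. if f i = c then s 3 i + 1 else 0))"
  have "runs_to support_prog (n * (Suc (Suc (Suc (Suc 0))) + 2) + 2) s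
    (\<lambda>s'. same_except {3, 4, 6, 7, 11} s s' \<and> s' 6 0 = s 6 0 + n * m \<and>
       (\<forall>i<n. s' 3 i = s 3 i + 1) \<and> (\<forall>i<n. s' 11 i = f i) \<and>
       (\<forall>c<m. s' 4 c = (\<Sum>i<n. if f i = c then s 3 i + 1 else 0)))"
    unfolding support_prog_def
  proof (rule runs_to_for_loop[where Inv = ?Inv])
    fix k s'
    assume "k < n" "?Inv k s'"
    then show "runs_to
      (Seq (Write 11 (var 7) (Read 1 (var 6)))
      (Seq (Write 3 (var 7) (Plus (Read 3 (var 7)) (Const 1)))
      (Seq (Write 4 (Read 11 (var 7)) (Plus (Read 4 (Read 11 (var 7))) (Read 3 (var 7))))
           (Write 6 (Const 0) (Plus (var 6) (Read 0 (Const 1)))))))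
      (Suc (Suc (Suc (Suc 0)))) s' (\<lambda>s'. ?Inv (Suc k) (s'(7 := (s' 7)(0 := Suc (s' 7 0)))))"
      using assms
      by (intro runs_to_Write_Seq runs_to_Write) (auto simp: same_except_def less_Suc_eq)
  qed (use assms in \<open>auto simp: same_except_def\<close>)
  then show ?thesis by (simp add: numeral_eq_Suc)
qed

lemma runs_to_winner_prog:
  assumes "s 0 1 = m" "m \<ge> 1"
  shows "runs_to winner_prog (m * 4 + 3) s
    (\<lambda>s'. same_except {7, 8} s s' \<and> s' 8 0 < m \<and>
       (\<forall>c<m. s 4 c \<le> s 4 (s' 8 0)) \<and> (\<forall>c<s' 8 0. s 4 c < s 4 (s' 8 0)))"
proof -
  let ?Q = "\<lambda>s'. same_except {7, 8} s s' \<and> s' 8 0 < m \<and>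
       (\<forall>c<m. s 4 c \<le> s 4 (s' 8 0)) \<and> (\<forall>c<s' 8 0. s 4 c < s 4 (s' 8 0))"
  let ?Inv = "\<lambda>k s'. same_except {7, 8} s s' \<and> s' 7 0 = k \<and> s' 8 0 < m \<and> (k = 0 \<longrightarrow> s' 8 0 = 0) \<and>
       (\<forall>c<k. s 4 c \<le> s 4 (s' 8 0)) \<and> (\<forall>c<s' 8 0. s 4 c < s 4 (s' 8 0))"
  have "runs_to winner_prog (Suc (m * (Suc (Suc 0) + 2) + 2)) s ?Q"
    unfolding winner_prog_def
  proof (rule runs_to_Write_Seq, rule runs_to_for_loop[where Inv = ?Inv])
    fix k s'
    assume "k < m" "?Inv k s'"
    then show "runs_to
      (IfLess (Read 4 (var 8)) (Read 4 (var 7)) (Write 8 (Const 0) (var 7)) Skip)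
      (Suc (Suc 0)) s' (\<lambda>s'. ?Inv (Suc k) (s'(7 := (s' 7)(0 := Suc (s' 7 0)))))"
      by (intro runs_to_IfLess runs_to_Write runs_to_Skip)
        (auto simp: same_except_def less_Suc_eq intro: le_less_trans less_imp_le order_trans)
  qed (use assms in \<open>auto simp: same_except_def\<close>)
  then show ?thesis by (simp add: numeral_eq_Suc)
qed

text \<open>The invariant looks ahead: deducting the current remainder from the voters still to come
  yields the fixed final result. The budgets \<open>b'\<close> are existential because the memory
  determines them only for \<open>i < n\<close>, whereas \<open>deduct\<close> acts on functions on
  all naturals.\<close>

lemma runs_to_deduct_prog:
  assumes "s 0 0 = n" "\<forall>i<n. b i = real (s 3 i) / real n"
  shows "runs_to deduct_prog (n * 7 + 2) s
    (\<lambda>s'. same_except {3, 7, 9, 10} s s' \<and>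
       (\<forall>i<n. real (s' 3 i) / real n =
          deduct (real (s 9 0) / real n) (filter (\<lambda>i. s 11 i = s 8 0) [0..<n]) b i))"
proof -
  let ?D = "\<lambda>k. filter (\<lambda>i. s 11 i = s 8 0) [k..<n]"
  let ?result = "deduct (real (s 9 0) / real n) (?D 0) b"
  let ?Q = "\<lambda>s'. same_except {3, 7, 9, 10} s s' \<and> (\<forall>i<n. real (s' 3 i) / real n = ?result i)"
  let ?Inv = "\<lambda>k s'. same_except {3, 7, 9, 10} s s' \<and> s' 7 0 = k \<and>
     (\<exists>b'. (\<forall>i<n. b' i = real (s' 3 i) / real n) \<and>
        deduct (real (s' 9 0) / real n) (?D k) b' = ?result)"
  have "runs_to deduct_prog (n * (Suc (Suc (Suc (Suc (Suc 0)))) + 2) + 2) s ?Q"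
    unfolding deduct_prog_def
  proof (rule runs_to_for_loop[where Inv = ?Inv])
    fix k s'
    assume k: "k < n" and inv: "?Inv k s'"
    then obtain b' where b': "\<forall>i<n. b' i = real (s' 3 i) / real n"
      "deduct (real (s' 9 0) / real n) (?D k) b' = ?result" by blast
    have D: "?D k = (if s 11 k = s 8 0 then k # ?D (Suc k) else ?D (Suc k))"
      using k by (simp add: upt_conv_Cons)
    show "runs_to
      (IfLess (Read 11 (var 7)) (var 8) Skip
      (IfLess (var 8) (Read 11 (var 7)) Skip
        (Seq (Write 10 (Const 0) (Read 3 (var 7)))
        (Seq (Write 3 (var 7) (Minus (Read 3 (var 7)) (var 9)))
             (Write 9 (Const 0) (Minus (var 9) (var 10)))))))
      (Suc (Suc (Suc (Suc (Suc 0))))) s' (\<lambda>s'. ?Inv (Suc k) (s'(7 := (s' 7)(0 := Suc (s' 7 0)))))"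
    proof (cases "s 11 k = s 8 0")
      case False
      then have "deduct (real (s' 9 0) / real n) (?D (Suc k)) b' = ?result"
        using b'(2) D by simp
      then have "?Inv (Suc k) (s'(7 := (s' 7)(0 := Suc (s' 7 0))))"
        using inv b'(1) by (auto simp: same_except_def)
      then show ?thesis
        using False inv by (intro runs_to_IfLess runs_to_Skip) (auto simp: same_except_def)
    next
      case True
      define p where "p = min (real (s' 9 0) / real n) (b' k)"
      define b'' where "b'' = b'(k := b' k - p)"
      have p: "p = real (min (s' 9 0) (s' 3 k)) / real n"
        using b'(1) k by (auto simp: p_def min_def divide_le_cancel)
      have "deduct (real (s' 9 0) / real n - p) (?D (Suc k)) b'' = ?result"
        using b'(2) D True by (simp add: Let_def p_def b''_def)
      moreover have "real (s' 9 0) / real n - p = real (s' 9 0 - s' 3 k) / real n"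
        by (auto simp: p min_def diff_divide_distrib of_nat_diff)
      ultimately have "deduct (real (s' 9 0 - s' 3 k) / real n) (?D (Suc k)) b'' = ?result"
        by simp
      moreover have "\<forall>i<n. b'' i = real (((s' 3)(k := s' 3 k - s' 9 0)) i) / real n"
        using b'(1) by (auto simp: b''_def p min_def diff_divide_distrib of_nat_diff)
      ultimately have "?Inv (Suc k) (s'(10 := (s' 10)(0 := s' 3 k),
          3 := (s' 3)(k := s' 3 k - s' 9 0), 9 := (s' 9)(0 := s' 9 0 - s' 3 k),
          7 := (s' 7)(0 := Suc (s' 7 0))))"
        using inv by (intro conjI exI[of _ b'']) (auto simp: same_except_def)
      then show ?thesis
        using True inv
        by (intro runs_to_IfLess runs_to_Write_Seq runs_to_Write) (auto simp: same_except_def)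
    qed
  qed (use assms in \<open>auto simp: same_except_def\<close>)
  then show ?thesis by (simp add: numeral_eq_Suc)
qed


lemma runs_to_charge_prog:
  assumes "s 0 0 = n" "n \<ge> 1" "length R = n" "\<forall>i<n. s 11 i = first_choice R i"
    and b: "\<forall>i<n. b i = real (s 3 i) / real n"
    and support: "real (s 4 (s 8 0)) / real n = support_budget b R (s 8 0)"
  shows "runs_to charge_prog (n * 7 + 3) s
    (\<lambda>s'. same_except {3, 7, 9, 10} s s' \<and>
       (\<forall>i<n. real (s' 3 i) / real n = charge b R (s 8 0) i))"
proof -
  let ?q = "s 4 (s 8 0) - (s 4 (s 8 0) - n)"
  let ?s = "s(9 := (s 9)(0 := ?q))"
  have "supporters R (s 8 0) = set (filter (\<lambda>i. s 11 i = s 8 0) [0..<n])"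
    using assms(3,4) by (auto simp: supporters_def)
  then have "sorted_list_of_set (supporters R (s 8 0)) = filter (\<lambda>i. s 11 i = s 8 0) [0..<n]"
    by (simp add: sorted_list_of_set.idem_if_sorted_distinct sorted_wrt_filter del: set_filter set_upt)
  moreover have "min 1 (support_budget b R (s 8 0)) = real ?q / real n"
    using assms(2) by (auto simp: support[symmetric] min_def field_simps)
  ultimately have charge: "charge b R (s 8 0) =
      deduct (real ?q / real n) (filter (\<lambda>i. s 11 i = s 8 0) [0..<n]) b"
    by (simp add: charge_def)
  have "runs_to deduct_prog (n * 7 + 2) ?s
    (\<lambda>s'. same_except {3, 7, 9, 10} ?s s' \<and>
       (\<forall>i<n. real (s' 3 i) / real n = charge b R (s 8 0) i))"
    using runs_to_deduct_prog[of ?s n b] assms(1) b by (simp add: charge)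
  then have "runs_to deduct_prog (n * 7 + 2) ?s
    (\<lambda>s'. same_except {3, 7, 9, 10} s s' \<and>
       (\<forall>i<n. real (s' 3 i) / real n = charge b R (s 8 0) i))"
    by (rule runs_to_mono) (auto simp: same_except_def)
  then have "runs_to charge_prog (Suc (n * 7 + 2)) s
    (\<lambda>s'. same_except {3, 7, 9, 10} s s' \<and>
       (\<forall>i<n. real (s' 3 i) / real n = charge b R (s 8 0) i))"
    unfolding charge_prog_def using assms(1) by (intro runs_to_Write_Seq) simp
  then show ?thesis by (simp add: numeral_eq_Suc)
qed

text \<open>Right after the voters have been paid, all budgets are positive.  So the maximum over all
  candidates is only attained by first choices.\<close>

lemma choose_winner_eqI:
  assumes "R \<noteq> []" "first_choices R \<subseteq> {..<m}" "\<forall>i. 0 < b i"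
    and max: "\<forall>c<m. support_budget b R c \<le> support_budget b R w"
    and least: "\<forall>c<w. support_budget b R c < support_budget b R w"
  shows "choose_winner b R = w"
proof -
  have "0 \<in> supporters R (first_choice R 0)"
    using assms(1) by (simp add: supporters_def)
  then have "0 < support_budget b R (first_choice R 0)"
    unfolding support_budget_def using assms(3) by (intro sum_pos) auto
  moreover have "first_choice R 0 < m"
    using assms(1,2) by (auto simp: first_choices_def)
  ultimately have "0 < support_budget b R w" using max by (auto intro: less_le_trans)
  then have "supporters R w \<noteq> {}" by (auto simp: support_budget_def)
  then have "w \<in> first_choices R" by (auto simp: supporters_def first_choices_def)
  then show ?thesis
    unfolding choose_winner_def using assms(2) max least
    by (intro Least_equality) (auto simp: not_less[symmetric])
qed

text \<open>Only the heads of rankings are ever read, and these lie at the multiples of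
  \<open>m\<close>.\<close>

lemma input_first_choice:
  assumes "profile n m P" "j < length P" "i < n"
  shows "input_memory n m P 1 (j * (n * m) + i * m) = first_choice (P ! j) i"
proof -
  have m: "m \<ge> 1" using profileD(6)[OF assms(1,2)] .
  have im: "i * m < n * m" using m assms(3) by simp
  have "j * (n * m) + i * m < Suc j * (n * m)" using im by simp
  also have "\<dots> \<le> length P * (n * m)" using assms(2) by (intro mult_le_mono1) simp
  finally have "j * (n * m) + i * m < length P * n * m" by (simp add: mult.assoc)
  moreover have "(j * (n * m) + i * m) div (n * m) = j"
    using im by (simp add: div_mult_self3)
  moreover have "(j * (n * m) + i * m) div m mod n = i"
  proof -
    have "j * (n * m) + i * m = (j * n + i) * m" by (simp add: algebra_simps)
    then show ?thesis using m assms(3) by simp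
  qed
  moreover have "(j * (n * m) + i * m) mod m = 0"
    by (metis add_mult_distrib mod_mult_self2_is_0 mult.assoc)
  moreover have "P ! j ! i \<noteq> []"
    using length_ranking[OF assms] m by auto
  ultimately show ?thesis
    by (simp add: input_memory_def first_choice_def hd_conv_nth)
qed

text \<open>Only what passes from one round to the next is recorded; the arrays 4 and 7 to 11 are
  scratch space that each round overwrites before reading.\<close>

definition round_inv :: "nat \<Rightarrow> nat \<Rightarrow> profile \<Rightarrow> nat \<Rightarrow> memory \<Rightarrow> bool" where
  "round_inv n m P j s \<longleftrightarrow> (\<forall>y\<in>{0, 1}. s y = input_memory n m P y) \<and> s 5 0 = j \<and>
     s 6 0 = j * (n * m) \<and> (\<forall>i<n. real (s 3 i) / real n = budgets_at P j i) \<and>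
     (\<forall>j'<j. s 2 j' = replenished P ! j')"

lemma runs_to_round_prog:
  assumes P: "profile n m P" "j < length P" and inv: "round_inv n m P j s"
  shows "runs_to round_prog (13 * n + 7 * m + 11) s
    (\<lambda>s'. round_inv n m P (Suc j) (s'(5 := (s' 5)(0 := Suc (s' 5 0)))))"
proof -
  note PD = profileD[OF P]
  let ?R = "P ! j"
  define b where "b = receive n (budgets_at P j)"
  define f where "f = first_choice ?R"
  have size: "s 0 0 = n" "s 0 1 = m"
    using inv by (auto simp: round_inv_def input_memory_def)
  have f: "\<forall>i<n. f i < m" using first_choice_less[OF P] by (simp add: f_def)
  have input: "\<forall>i<n. s 1 (s 6 0 + i * m) = f i"
    using inv input_first_choice[OF P] by (simp add: round_inv_def f_def)
  have b: "b i = real (s 3 i + 1) / real n" if "i < n" for i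
    using inv that by (simp add: round_inv_def b_def receive_def add_divide_distrib)
  have b_pos: "\<forall>i. 0 < b i"
    using P(2) PD(5) by (auto simp: b_def receive_def budgets_at_nonneg intro: add_nonneg_pos)
  have support: "real (\<Sum>i<n. if f i = c then s 3 i + 1 else 0) / real n = support_budget b ?R c" for c
  proof -
    have "supporters ?R c = {i \<in> {..<n}. f i = c}"
      using PD(1) by (auto simp: supporters_def f_def)
    then have "support_budget b ?R c = (\<Sum>i<n. if f i = c then b i else 0)"
      by (simp only: support_budget_def sum.inter_filter[OF finite_lessThan])
    also have "\<dots> = (\<Sum>i<n. real (if f i = c then s 3 i + 1 else 0) / real n)"
      by (intro sum.cong) (auto simp: b)
    finally show ?thesis by (simp add: sum_divide_distrib[symmetric] del: of_nat_add of_nat_Suc)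
  qed
  \<comment> \<open>This composes the frame conditions of the four fragments with the write to array
    2 in between.\<close>
  have after_charge: "round_inv n m P (Suc j) (s4(5 := (s4 5)(0 := Suc (s4 5 0))))"
    if s1: "same_except {4, 7} s s1"
      and s2: "same_except {3, 4, 6, 7, 11} s1 s2" "s2 6 0 = s1 6 0 + n * m"
      and s3: "same_except {7, 8} s2 s3"
      and w: "s3 8 0 = replenished P ! j"
      and s4: "same_except {3, 7, 9, 10} (s3(2 := (s3 2)(j := s3 8 0))) s4"
        "\<forall>i<n. real (s4 3 i) / real n = charge b ?R (s3 8 0) i"
    for s1 s2 s3 s4
  proof -
    have "budgets_at P (Suc j) = charge b ?R (replenished P ! j)"
      using P PD(1) by (simp add: budgets_at_Suc replenish_step_def Let_def b_def replenished_nth)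
    then show ?thesis
      using inv s1 s2 s3 s4 w by (auto simp: round_inv_def same_except_def less_Suc_eq)
  qed
  have "runs_to round_prog ((m * 3 + 2) + ((n * 6 + 2) + ((m * 4 + 3) + Suc (n * 7 + 3)))) s
    (\<lambda>s'. round_inv n m P (Suc j) (s'(5 := (s' 5)(0 := Suc (s' 5 0)))))"
    unfolding round_prog_def
  proof (rule runs_to_Seq, rule runs_to_mono[OF runs_to_clear_prog[where s = s, OF size(2)] order_refl])
    fix s1 assume s1: "same_except {4, 7} s s1 \<and> (\<forall>c<m. s1 4 c = 0)"
    then have eq1: "s1 y = s y" if "y \<notin> {4, 7}" for y using that by (simp add: same_except_def)
    show "runs_to (Seq support_prog (Seq winner_prog
        (Seq (Write 2 (var 5) (var 8)) charge_prog)))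
      ((n * 6 + 2) + ((m * 4 + 3) + Suc (n * 7 + 3))) s1
      (\<lambda>s'. round_inv n m P (Suc j) (s'(5 := (s' 5)(0 := Suc (s' 5 0)))))"
    proof (rule runs_to_Seq,
        rule runs_to_mono[OF runs_to_support_prog[where s = s1 and n = n and m = m and f = f] order_refl])
      fix s2 assume s2: "same_except {3, 4, 6, 7, 11} s1 s2 \<and> s2 6 0 = s1 6 0 + n * m \<and>
         (\<forall>i<n. s2 3 i = s1 3 i + 1) \<and> (\<forall>i<n. s2 11 i = f i) \<and>
         (\<forall>c<m. s2 4 c = (\<Sum>i<n. if f i = c then s1 3 i + 1 else 0))"
      then have eq2: "s2 y = s1 y" if "y \<notin> {3, 4, 6, 7, 11}" for y
        using that by (simp add: same_except_def)
      have sup2: "real (s2 4 c) / real n = support_budget b ?R c" if "c < m" for c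
      proof -
        have "s1 3 = s 3" by (simp add: eq1)
        from s2[unfolded this] show ?thesis using that support[of c] by simp
      qed
      show "runs_to (Seq winner_prog (Seq (Write 2 (var 5) (var 8)) charge_prog))
        ((m * 4 + 3) + Suc (n * 7 + 3)) s2
        (\<lambda>s'. round_inv n m P (Suc j) (s'(5 := (s' 5)(0 := Suc (s' 5 0)))))"
      proof (rule runs_to_Seq,
          rule runs_to_mono[OF runs_to_winner_prog[where s = s2 and m = m] order_refl])
        fix s3 assume s3: "same_except {7, 8} s2 s3 \<and> s3 8 0 < m \<and>
          (\<forall>c<m. s2 4 c \<le> s2 4 (s3 8 0)) \<and> (\<forall>c<s3 8 0. s2 4 c < s2 4 (s3 8 0))"
        then have eq3: "s3 y = s2 y" if "y \<notin> {7, 8}" for y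
          using that by (simp add: same_except_def)
        have "choose_winner b ?R = s3 8 0"
        proof (rule choose_winner_eqI)
          show "first_choices ?R \<subseteq> {..<m}" using f PD(1) by (auto simp: first_choices_def f_def)
          show "\<forall>c<m. support_budget b ?R c \<le> support_budget b ?R (s3 8 0)"
            using s3 PD(5) by (auto simp: sup2[symmetric] divide_right_mono)
          show "\<forall>c<s3 8 0. support_budget b ?R c < support_budget b ?R (s3 8 0)"
          proof (intro allI impI)
            fix c assume "c < s3 8 0"
            moreover from this s3 have "c < m" by simp
            ultimately show "support_budget b ?R c < support_budget b ?R (s3 8 0)"
              using s3 PD(5) by (auto simp: sup2[symmetric] divide_strict_right_mono)
          qed
        qed (use PD b_pos in auto)
        then have w: "s3 8 0 = replenished P ! j"
          using P PD(1) by (simp add: replenished_nth b_def)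
        let ?s = "s3(2 := (s3 2)(j := s3 8 0))"
        have j: "s3 5 0 = j" using inv by (simp add: eq3 eq2 eq1 round_inv_def)
        have "runs_to charge_prog (n * 7 + 3) ?s
            (\<lambda>s'. same_except {3, 7, 9, 10} ?s s' \<and>
               (\<forall>i<n. real (s' 3 i) / real n = charge b ?R (?s 8 0) i))"
          using s2 s3 sup2 b PD(1,5)
          by (intro runs_to_charge_prog) (auto simp: eq1 eq2 eq3 size f_def)
        then have "runs_to charge_prog (n * 7 + 3) ?s
            (\<lambda>s'. round_inv n m P (Suc j) (s'(5 := (s' 5)(0 := Suc (s' 5 0)))))"
        proof (rule runs_to_mono[OF _ order_refl])
          fix s4
          assume "same_except {3, 7, 9, 10} ?s s4 \<and>
              (\<forall>i<n. real (s4 3 i) / real n = charge b ?R (?s 8 0) i)"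
          then show "round_inv n m P (Suc j) (s4(5 := (s4 5)(0 := Suc (s4 5 0))))"
            using s1 s2 s3 w by (intro after_charge[of s1 s2 s3 s4]) simp_all
        qed
        then show "runs_to (Seq (Write 2 (var 5) (var 8)) charge_prog) (Suc (n * 7 + 3)) s3
            (\<lambda>s'. round_inv n m P (Suc j) (s'(5 := (s' 5)(0 := Suc (s' 5 0)))))"
          by (intro runs_to_Write_Seq) (simp add: j)
      qed (use PD size in \<open>simp_all add: eq1 eq2\<close>)
    qed (use s1 f input size in \<open>simp_all add: eq1\<close>)
  qed
  then show ?thesis by (rule runs_to_mono) auto
qed

lemma polynomial_time_replenished: "polynomial_time replenished"
  unfolding polynomial_time_def
\<comment> \<open>The same number serves as factor and exponent. It is 13 + 7 + 11 + 2 for the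
  rounds plus 2 for the outer loop; the exponent is harmless because the input size is at least
  1.\<close>
proof (rule exI[of _ replenished_prog], rule exI[of _ 35], intro allI impI)
  fix n m P assume P: "profile n m P"
  define N where "N = n * m * length P"
  have pos: "n \<ge> 1" "m \<ge> 1" "length P \<ge> 1" using P by (auto simp: profile_def)
  have "runs_to replenished_prog (length P * ((13 * n + 7 * m + 11) + 2) + 2) (input_memory n m P)
      (\<lambda>s. \<forall>j<length P. s 2 j = replenished P ! j)"
    unfolding replenished_prog_def
  proof (rule runs_to_for_loop[where Inv = "round_inv n m P"])
    show "round_inv n m P 0 ((input_memory n m P)(5 := (input_memory n m P 5)(0 := 0)))"
      by (simp add: round_inv_def input_memory_def)
    show "s 5 0 = k \<and> val (Read 0 (Const 2)) s = length P" if "round_inv n m P k s" for k s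
      using that by (simp add: round_inv_def input_memory_def)
  qed (use P runs_to_round_prog in \<open>auto simp: round_inv_def\<close>)
  then obtain t s where run: "run replenished_prog (input_memory n m P) t s"
      "t \<le> length P * ((13 * n + 7 * m + 11) + 2) + 2" "\<forall>j<length P. s 2 j = replenished P ! j"
    by (auto simp: runs_to_def)
  have "n \<le> n * m" "m \<le> n * m" "1 \<le> n * m" using pos by auto
  then have "(13 * n + 7 * m + 11) + 2 \<le> 33 * (n * m)" by linarith
  then have "length P * ((13 * n + 7 * m + 11) + 2) \<le> length P * (33 * (n * m))"
    by (rule mult_le_mono2)
  also have "\<dots> = 33 * N" by (simp add: N_def)
  finally have "t \<le> 33 * N + 2" using run(2) by simp
  moreover have "1 \<le> N" using pos by (simp add: N_def Suc_le_eq)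
  ultimately have "t \<le> 35 * N" by simp
  also have "\<dots> \<le> 35 * N ^ 35" using pos by (simp add: N_def self_le_power)
  finally show "\<exists>t s. run replenished_prog (input_memory n m P) t s \<and>
      t \<le> 35 * (n * m * length P) ^ 35 \<and> (\<forall>j<length P. s 2 j = replenished P ! j)"
    using run unfolding N_def by blast
qed

section \<open>Lower bounds on the loss\<close>

text \<open>A lone voter in a single round is owed one win and cannot get two. This settles
  optimality for \<open>d = 2\<close> and lets optimal losses be sought among the naturals.\<close>

lemma achieves_nonneg:
  assumes "achieves_interval_loss d L F" "d \<ge> 1"
  shows "0 \<le> L"
proof -
  define P :: profile where "P = [[[0]]]"
  have P: "profile 1 1 P"
    by (auto simp: P_def profile_def)
  have "at_most_first_choices d P"
    using assms(2) by (auto simp: P_def at_most_first_choices_def first_choices_def lessThan_Suc)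
  moreover have "{0} \<in> intervals (length P)"
    by (auto simp: P_def intervals_def intro!: exI[of _ 0])
  ultimately have pjr: "all_rank_PJR 1 1 P (F P) L {0}"
    using assms(1) P by (simp add: achieves_interval_loss_def)
  have agree: "{j \<in> {0}. (\<Inter>i\<in>{0}. top P j i 1) \<noteq> {}} = {0}"
    by (auto simp: P_def top_def)
  let ?wins = "card {j \<in> {0}. F P ! j \<in> (\<Union>i\<in>{0}. top P j i 1)}"
  have "1 - L \<le> int ?wins"
    using pjr[unfolded all_rank_PJR_def, rule_format, of "\<lambda>_ _. 1" "{0}" 1]
    by (simp only: agree) (simp add: voter_group_def)
  moreover have "?wins \<le> card {0::nat}"
    by (intro card_mono) auto
  ultimately show ?thesis by simp
qed

text \<open>A group of size at least \<open>n / card I\<close> that agrees throughout is owed a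
  whole win, and a fixed rank is a constant choice of cutoffs. Impossibility for the weaker axiom
  thus transfers to PJR.\<close>

lemma all_rank_PJR_imp_fixed_rank_wJR:
  assumes "all_rank_PJR n m P W L I" "L \<le> 0" "finite I" "I \<noteq> {}" "n \<ge> 1"
  shows "fixed_rank_wJR n m P W I"
  unfolding fixed_rank_wJR_def
proof (intro ballI allI impI)
  fix r S
  assume r: "r \<in> {1..m}" and S: "voter_group n S" and size: "real n / real (card I) \<le> real (card S)"
    and "\<forall>j\<in>I. (\<Inter>i\<in>S. top P j i r) \<noteq> {}"
  then have agree: "{j \<in> I. (\<Inter>i\<in>S. top P j i r) \<noteq> {}} = I" by auto
  have pos: "card I > 0" using assms(3,4) by (simp add: card_gt_0_iff)
  have "\<lfloor>real (card I) * real (card S) / real n\<rfloor> - L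
      \<le> int (card {j \<in> I. W ! j \<in> (\<Union>i\<in>S. top P j i r)})"
    using assms(1)[unfolded all_rank_PJR_def, rule_format, of "\<lambda>_ _. r" S "card I"] r S pos
    by (simp only: agree)
  moreover have "1 \<le> \<lfloor>real (card I) * real (card S) / real n\<rfloor>"
    using size pos assms(5) by (simp add: le_floor_iff field_simps)
  ultimately have "card {j \<in> I. W ! j \<in> (\<Union>i\<in>S. top P j i r)} \<noteq> 0"
    using assms(2) by linarith
  then show "\<exists>j\<in>I. W ! j \<in> (\<Union>i\<in>S. top P j i r)"
    by (auto simp: card_eq_0_iff)
qed

text \<open>The voters split into parts of relative sizes 1/2, 1/3 and 1/6, which form an infeasible
  instance of pinwheel scheduling: candidate 0 has to win one of any two consecutive rounds,
  candidate 1 one of any three, and candidate 2 one of any six.\<close>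

definition pinwheel_profile :: profile where
  "pinwheel_profile = replicate 8 ([[0,1,2], [0,1,2], [0,1,2], [1,0,2], [1,0,2], [2,1,0]])"

lemma all_less_6: "(\<forall>i<6. Q i) \<longleftrightarrow> Q 0 \<and> Q 1 \<and> Q 2 \<and> Q 3 \<and> Q 4 \<and> Q (5::nat)"
  by (auto simp: numeral_eq_Suc All_less_Suc)

lemma pinwheel_profile: "profile 6 3 pinwheel_profile"
proof -
  have "{..<3} = {0, 1, 2::nat}" by auto
  then show ?thesis
    by (auto simp: profile_def pinwheel_profile_def all_less_6)
qed

lemma static_pinwheel: "static pinwheel_profile"
  by (auto simp: static_def pinwheel_profile_def)

lemma euclidean_pinwheel: "euclidean_1d pinwheel_profile"
  unfolding euclidean_1d_def
proof (intro allI impI)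
  fix j assume j: "j < length pinwheel_profile"
  \<comment> \<open>Candidates stand at 0, 1, 2. The middle voters are moved from 1 to 9/10 to break
    their tie between candidates 0 and 2.\<close>
  let ?x = "\<lambda>i::nat. if i < 3 then 0 else if i < 5 then 9/10 else 2 :: real"
  have "\<forall>i<6. sorted_wrt (\<lambda>c c'. \<bar>?x i - real c\<bar> < \<bar>?x i - real c'\<bar>) (pinwheel_profile ! j ! i)"
    using j unfolding all_less_6 by (auto simp: pinwheel_profile_def)
  moreover have "length (pinwheel_profile ! j) = 6"
    using j by (simp add: pinwheel_profile_def)
  ultimately have "\<forall>i<length (pinwheel_profile ! j).
      sorted_wrt (\<lambda>c c'. \<bar>?x i - real c\<bar> < \<bar>?x i - real c'\<bar>) (pinwheel_profile ! j ! i)"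
    by (simp only:)
  then have "\<exists>y :: nat \<Rightarrow> real. \<forall>i<length (pinwheel_profile ! j).
      sorted_wrt (\<lambda>c c'. \<bar>?x i - y c\<bar> < \<bar>?x i - y c'\<bar>) (pinwheel_profile ! j ! i)"
    by (rule exI[of _ real])
  then show "\<exists>(x :: nat \<Rightarrow> real) (y :: nat \<Rightarrow> real). \<forall>i<length (pinwheel_profile ! j).
      sorted_wrt (\<lambda>c c'. \<bar>x i - y c\<bar> < \<bar>x i - y c'\<bar>) (pinwheel_profile ! j ! i)"
    by (rule exI[of _ ?x])
qed

lemma at_most_first_choices_pinwheel: "at_most_first_choices 3 pinwheel_profile"
  unfolding at_most_first_choices_def
proof (intro allI impI)
  fix j assume "j < length pinwheel_profile"
  then have "first_choices (pinwheel_profile ! j) \<subseteq> {0, 1, 2}"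
    by (auto simp: first_choices_def first_choice_def pinwheel_profile_def
        less_Suc_eq numeral_eq_Suc)
  from card_mono[OF _ this] show "card (first_choices (pinwheel_profile ! j)) \<le> 3"
    by simp
qed

text \<open>A round won by candidate 2 must have candidate 0 winning on both sides, which leaves
  three consecutive rounds without candidate 1.\<close>

lemma pinwheel_no_fixed_rank_wJR:
  assumes "\<forall>I\<in>intervals (length pinwheel_profile). fixed_rank_wJR 6 3 pinwheel_profile W I"
    and "winner_seq 3 pinwheel_profile W"
  shows False
proof -
  have len: "length pinwheel_profile = 8" by (simp add: pinwheel_profile_def)
  have wins: "\<exists>j\<in>{a..b}. W ! j = c"
    if "a \<le> b" "b < 8" and S: "voter_group 6 S" and size: "6 \<le> card S * Suc (b - a)"
      and c: "\<forall>i\<in>S. hd (pinwheel_profile ! 0 ! i) = c" for a b c S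
  proof -
    have top: "top pinwheel_profile j i 1 = {c}" if "j \<in> {a..b}" "i \<in> S" for i j
    proof -
      have "j < 8" "i < 6" using that \<open>b < 8\<close> S by (auto simp: voter_group_def)
      then have "pinwheel_profile ! j ! i = pinwheel_profile ! 0 ! i"
          "pinwheel_profile ! 0 ! i \<noteq> []"
        using all_less_6[of "\<lambda>i. pinwheel_profile ! 0 ! i \<noteq> []"]
        by (auto simp: pinwheel_profile_def)
      then show ?thesis using c that(2)
        by (cases "pinwheel_profile ! 0 ! i") (auto simp: top_def)
    qed
    have "fixed_rank_wJR 6 3 pinwheel_profile W {a..b}"
      using assms(1) that(1,2) by (auto simp: intervals_def len)
    moreover have "real 6 / real (card {a..b}) \<le> real (card S)"
    proof -
      have "real 6 \<le> real (card S * Suc (b - a))" using size by (simp only: of_nat_le_iff)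
      then show ?thesis using \<open>a \<le> b\<close> by (simp add: field_simps Suc_diff_le)
    qed
    moreover have "\<forall>j\<in>{a..b}. (\<Inter>i\<in>S. top pinwheel_profile j i 1) \<noteq> {}"
      using top by auto
    ultimately have "\<exists>j\<in>{a..b}. W ! j \<in> (\<Union>i\<in>S. top pinwheel_profile j i 1)"
      using S by (auto simp: fixed_rank_wJR_def)
    then show ?thesis using top by auto
  qed
  have 0: "W ! a = 0 \<or> W ! Suc a = 0" if "Suc a < 8" for a
    using wins[of a "Suc a" "{0, 1, 2}" 0] that
    by (auto simp: voter_group_def pinwheel_profile_def atLeastAtMostSuc_conv)
  have 1: "W ! a = 1 \<or> W ! Suc a = 1 \<or> W ! Suc (Suc a) = 1" if "Suc (Suc a) < 8" for a
    using wins[of a "Suc (Suc a)" "{3, 4}" 1] that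
    by (auto simp: voter_group_def pinwheel_profile_def atLeastAtMostSuc_conv)
  \<comment> \<open>Leaving out the outermost of the 8 rounds guarantees that the round found has
    neighbours on both sides.\<close>
  have "\<exists>j\<in>{1..6}. W ! j = 2"
    by (rule wins[of 1 6 "{5}" 2]) (auto simp: voter_group_def pinwheel_profile_def)
  then obtain j where "W ! j = 2" "1 \<le> j" "j \<le> 6" by auto
  then obtain a where a: "W ! Suc a = 2" "Suc (Suc a) < 8"
    by (cases j) auto
  then have "W ! a = 0" "W ! Suc (Suc a) = 0"
    using 0[of a] 0[of "Suc a"] by auto
  then show False using 1[of a] a by auto
qed

lemma three_first_choices_loss:
  assumes "offline F" "achieves_interval_loss 3 L F"
  shows "1 \<le> L"
proof (rule ccontr)
  assume "\<not> 1 \<le> L"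
  then have "fixed_rank_wJR 6 3 pinwheel_profile (F pinwheel_profile) I"
    if "I \<in> intervals (length pinwheel_profile)" for I
    using that assms(2) pinwheel_profile at_most_first_choices_pinwheel
    by (intro all_rank_PJR_imp_fixed_rank_wJR[where L = L])
      (auto simp: achieves_interval_loss_def intervals_def)
  moreover have "winner_seq 3 pinwheel_profile (F pinwheel_profile)"
    using assms(1) pinwheel_profile by (simp add: offline_def)
  ultimately show False using pinwheel_no_fixed_rank_wJR by blast
qed

section \<open>The Condorcet cycle\<close>

definition cyclic_profile :: "nat \<Rightarrow> nat \<Rightarrow> profile" where
  "cyclic_profile d T = replicate T (map (\<lambda>i. map (\<lambda>t. (i + t) mod d) [0..<d]) [0..<d])"

lemma mod_shift_inj:
  fixes i s t d :: nat
  assumes "(i + s) mod d = (i + t) mod d" "s < d" "t < d"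
  shows "s = t"
proof -
  have "int d dvd int s - int t"
    using assms(1) by (metis add_diff_cancel_left mod_eq_dvd_iff of_nat_add zmod_int)
  then have "s mod d = t mod d"
    by (metis mod_eq_dvd_iff of_nat_eq_iff zmod_int)
  then show ?thesis using assms(2,3) by simp
qed

lemma cyclic_profile:
  assumes "d \<ge> 1" "T \<ge> 1"
  shows "profile d d (cyclic_profile d T)" "at_most_first_choices d (cyclic_profile d T)"
proof -
  have inj: "inj_on (\<lambda>t. (i + t) mod d) {0..<d}" for i
    by (auto simp: inj_on_def dest: mod_shift_inj)
  have "(\<lambda>t. (i + t) mod d) ` {0..<d} = {..<d}" for i
    using assms inj by (intro card_subset_eq) (auto simp: card_image)
  then show "profile d d (cyclic_profile d T)"
    using assms inj by (auto simp: profile_def cyclic_profile_def distinct_map)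
  show "at_most_first_choices d (cyclic_profile d T)"
    using assms by (auto simp: at_most_first_choices_def cyclic_profile_def first_choices_def
        intro: order_trans[OF card_image_le])
qed

lemma top_cyclic_profile:
  "j < T \<Longrightarrow> i < d \<Longrightarrow> r \<le> d \<Longrightarrow> top (cyclic_profile d T) j i r = (\<lambda>t. (i + t) mod d) ` {..<r}"
  by (auto simp: top_def cyclic_profile_def take_map)

text \<open>No matter who wins a round, all voters except those who rank the winner first agree on a
  candidate that they prefer to the winner, namely the cyclic predecessor of the winner.\<close>

lemma cyclic_profile_loss:
  assumes "offline F" "achieves_interval_loss d L F" "T \<ge> 1" "T < d"
  shows "\<lfloor>real T * real (d - T) / real d\<rfloor> \<le> L"
proof -
  define P where "P = cyclic_profile d T"
  define W where "W = F P"
  \<comment> \<open>Voter \<open>i\<close> ranks candidate \<open>i\<close> first, so these are the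
    voters whose first choice never wins.\<close>
  define S where "S = {..<d} - (\<lambda>j. W ! j) ` {..<T}"
  \<comment> \<open>The cutoff is the number of candidates that voter \<open>i\<close> ranks above
    the winner. The value 1 for \<open>i = W ! j\<close> only keeps the cutoff in range for voters
    outside \<open>S\<close>.\<close>
  define r where "r i j = (if i = W ! j then 1 else (W ! j + d - i) mod d)" for i j
  have P: "profile d d P" "at_most_first_choices d P" "length P = T"
    using cyclic_profile[of d T] assms(3,4) by (auto simp: P_def) (simp add: cyclic_profile_def)
  have W: "W ! j < d" if "j < T" for j
    using assms(1) P that by (auto simp: offline_def winner_seq_def W_def)
  have "card ((\<lambda>j. W ! j) ` {..<T}) \<le> T"
    using card_image_le[of "{..<T}"] by simp
  then have card_S: "d - T \<le> card S"
    using diff_card_le_card_Diff[of "(\<lambda>j. W ! j) ` {..<T}" "{..<d}"] by (simp add: S_def)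
  then have S: "voter_group d S"
  proof -
    have "S \<noteq> {}" using card_S assms(4) by auto
    then show ?thesis by (auto simp: voter_group_def S_def)
  qed
  have r_cases: "(i < W ! j \<and> r i j = W ! j - i) \<or> (W ! j < i \<and> r i j = W ! j + d - i)"
    if "i < d" "j < T" "i \<noteq> W ! j" for i j
    using that W[of j] by (auto simp: r_def mod_if)
  have r: "r i j \<in> {1..d}" if "i < d" "j < T" for i j
    using r_cases[OF that] that W[of j] by (cases "i = W ! j") (auto simp: r_def)
  have S': "i < d" "j < T \<Longrightarrow> i \<noteq> W ! j" if "i \<in> S" for i j
    using that by (auto simp: S_def)
  have "(W ! j + d - 1) mod d \<in> top P j i (r i j)" if "i \<in> S" "j < T" for i j
  proof -
    have "i < d" "i \<noteq> W ! j" using S' that by auto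
    \<comment> \<open>The cyclic predecessor of the winner is the last candidate within the cutoff;
      the two cases are with and without wrapping around past \<open>d\<close>.\<close>
    then have "i + (r i j - 1) = W ! j + d - 1 \<or> i + (r i j - 1) + d = W ! j + d - 1"
      using r_cases[of i j] that by auto
    then have "(W ! j + d - 1) mod d = (i + (r i j - 1)) mod d"
      by (metis mod_add_self2)
    moreover have "r i j - 1 < r i j" and "r i j \<le> d"
      using r[of i j] \<open>i < d\<close> that by auto
    ultimately have "\<exists>t<r i j. (W ! j + d - 1) mod d = (i + t) mod d" by blast
    then show ?thesis
      using \<open>i < d\<close> \<open>r i j \<le> d\<close> that by (auto simp: P_def top_cyclic_profile)
  qed
  then have "(\<Inter>i\<in>S. top P j i (r i j)) \<noteq> {}" if "j < T" for j
    using that by blast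
  moreover have "j < T" if "j \<in> {0..T - 1}" for j
    using that assms(3) by auto
  ultimately have agree: "{j \<in> {0..T - 1}. (\<Inter>i\<in>S. top P j i (r i j)) \<noteq> {}} = {0..T - 1}"
    by blast
  have "W ! j \<notin> top P j i (r i j)" if "i \<in> S" "j < T" for i j
  proof
    assume "W ! j \<in> top P j i (r i j)"
    moreover have "r i j \<le> d" "i < d"
      using r[of i j] S'(1)[of i] S'(2)[of i j] that by auto
    ultimately obtain t where t: "t < r i j" "(i + t) mod d = W ! j"
      using \<open>j < T\<close> unfolding P_def by (auto simp: top_cyclic_profile)
    have "i < d" "i \<noteq> W ! j" using S' that by auto
    then have "(i + t < d \<and> i + t \<noteq> W ! j) \<or> (d \<le> i + t \<and> i + t - d < W ! j)"
      using r_cases[of i j] t(1) that W[of j] by linarith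
    moreover have "(i + t) mod d = (if i + t < d then i + t else i + t - d)"
      using \<open>i < d\<close> t(1) r[of i j] that(2) by (auto simp: mod_if)
    ultimately show False using t(2) by auto
  qed
  then have none: "{j \<in> {0..T - 1}. W ! j \<in> (\<Union>i\<in>S. top P j i (r i j))} = {}"
    using assms(3) by auto
  have "{0..T - 1} \<in> intervals (length P)"
    using assms(3) P(3) by (auto simp: intervals_def)
  then have "all_rank_PJR d d P W L {0..T - 1}"
    using assms(2) P by (auto simp: achieves_interval_loss_def W_def)
  moreover have "\<forall>i<d. \<forall>j\<in>{0..T - 1}. r i j \<in> {1..d}"
    using r assms(3) by auto
  moreover have "T = card {j \<in> {0..T - 1}. (\<Inter>i\<in>S. top P j i (r i j)) \<noteq> {}}"
    using assms(3) by (simp only: agree) simp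
  ultimately have "\<lfloor>real T * real (card S) / real d\<rfloor> - L
      \<le> int (card {j \<in> {0..T - 1}. W ! j \<in> (\<Union>i\<in>S. top P j i (r i j))})"
    using S assms(3) unfolding all_rank_PJR_def by (auto dest!: spec[of _ r] spec[of _ S])
  then have "\<lfloor>real T * real (card S) / real d\<rfloor> \<le> L"
    by (simp only: none) simp
  moreover have "\<lfloor>real T * real (d - T) / real d\<rfloor> \<le> \<lfloor>real T * real (card S) / real d\<rfloor>"
    using card_S by (intro floor_mono divide_right_mono mult_left_mono) auto
  ultimately show ?thesis by linarith
qed

text \<open>The product \<open>T * (d - T)\<close> is largest near \<open>T = d / 2\<close>, where
  the loss is at least \<open>(d - 1) / 4 - 1\<close> after rounding; this reaches
  \<open>d / 8\<close> exactly from \<open>d = 10\<close> on.\<close>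

lemma loss_linear_lower_bound:
  assumes "offline F" "achieves_interval_loss d L F" "d \<ge> 10"
  shows "real d / 8 \<le> real_of_int L"
proof -
  define T where "T = d div 2"
  have T: "2 * T \<le> d" "d \<le> 2 * T + 1" "1 \<le> T" "T < d"
    using assms(3) by (auto simp: T_def)
  have "real_of_int \<lfloor>real T * real (d - T) / real d\<rfloor> \<le> real_of_int L"
    using cyclic_profile_loss[OF assms(1,2) T(3,4)] by (simp only: of_int_le_iff)
  then have L: "real T * real (d - T) / real d - 1 \<le> real_of_int L"
    by linarith
  have "(real d - 1) / 2 * (real d / 2) \<le> real T * real (d - T)"
    using T by (intro mult_mono) (auto simp: of_nat_diff)
  then have "(real d - 1) / 2 * (real d / 2) / real d \<le> real T * real (d - T) / real d"
    by (rule divide_right_mono) simp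
  moreover have "(real d - 1) / 2 * (real d / 2) / real d = (real d - 1) / 4"
    using assms(3) by simp
  ultimately have "(real d - 1) / 4 \<le> real_of_int L + 1" using L by linarith
  then show ?thesis using assms(3) by simp
qed

section \<open>Optimal losses\<close>

text \<open>Achievable losses are nonnegative integers and include \<open>d - 2\<close>, so a least
  one exists.\<close>

lemma optimal_loss_exists:
  assumes "kind replenished" "d \<ge> 2"
  shows "\<exists>L. optimal_loss kind d L"
proof -
  let ?Q = "\<lambda>l::nat. \<exists>F. kind F \<and> achieves_interval_loss d (int l) F"
  have "?Q (d - 2)"
    using assms replenished_achieves[of d] by (auto simp: of_nat_diff)
  then have "?Q (LEAST l. ?Q l)" by (rule LeastI)
  moreover have "int (LEAST l. ?Q l) \<le> L'" if F: "kind F" "achieves_interval_loss d L' F" for L' F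
  proof -
    have "0 \<le> L'" using achieves_nonneg[OF F(2)] assms(2) by simp
    then have "?Q (nat L')" using F by auto
    then have "(LEAST l. ?Q l) \<le> nat L'" by (rule Least_le)
    then show ?thesis using \<open>0 \<le> L'\<close> by simp
  qed
  ultimately show ?thesis unfolding optimal_loss_def by blast
qed

text \<open>The hypotheses treat online and offline rules alike: \<open>replenished\<close> belongs
  to the class and gives the upper bound, while the lower bound holds for all offline rules.\<close>

lemma optimal_loss_theta:
  assumes "kind replenished" and "\<And>F. kind F \<Longrightarrow> offline F"
  shows "\<exists>opt :: nat \<Rightarrow> int. (\<forall>d\<ge>2. optimal_loss kind d (opt d)) \<and>
    (\<lambda>d. real_of_int (opt d)) \<in> \<Theta>(\<lambda>d. real d)"
proof -
  obtain opt where opt: "\<forall>d\<ge>2. optimal_loss kind d (opt d)"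
    using optimal_loss_exists[of kind] assms(1) by metis
  have bounds: "real d / 8 \<le> real_of_int (opt d) \<and> real_of_int (opt d) \<le> real d" if "d \<ge> 10" for d
  proof -
    have "optimal_loss kind d (opt d)" using opt that by simp
    then obtain F where "kind F" "achieves_interval_loss d (opt d) F"
      by (auto simp: optimal_loss_def)
    moreover have "opt d \<le> int d - 2"
      using \<open>optimal_loss kind d (opt d)\<close> assms(1) replenished_achieves[of d] that
      unfolding optimal_loss_def by auto
    ultimately show ?thesis
      using loss_linear_lower_bound[OF assms(2), of F d "opt d"] that by simp
  qed
  have "(\<lambda>d. real_of_int (opt d)) \<in> O(\<lambda>d. real d)"
    using bounds by (intro bigoI[of _ 1] eventually_sequentiallyI[of 10]) force
  moreover have "(\<lambda>d. real_of_int (opt d)) \<in> \<Omega>(\<lambda>d. real d)"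
    using bounds by (intro landau_omega.bigI[of "1/8"] eventually_sequentiallyI[of 10]) force+
  ultimately show ?thesis using opt by (auto intro!: exI[of _ opt] bigthetaI)
qed

lemma optimal_loss_2:
  assumes "kind replenished"
  shows "optimal_loss kind 2 0"
  unfolding optimal_loss_def
proof (intro conjI allI impI)
  show "\<exists>F. kind F \<and> achieves_interval_loss 2 0 F"
    using assms replenished_achieves[of 2] by auto
  show "0 \<le> L'" if "\<exists>F. kind F \<and> achieves_interval_loss 2 L' F" for L'
    using that achieves_nonneg[of 2] by auto
qed

lemma optimal_loss_3:
  assumes "kind replenished" and "\<And>F. kind F \<Longrightarrow> offline F"
  shows "optimal_loss kind 3 1"
  unfolding optimal_loss_def
proof (intro conjI allI impI)
  show "\<exists>F. kind F \<and> achieves_interval_loss 3 1 F"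
    using assms(1) replenished_achieves[of 3] by auto
  show "1 \<le> L'" if "\<exists>F. kind F \<and> achieves_interval_loss 3 L' F" for L'
    using that assms(2) three_first_choices_loss by blast
qed

theorem theorem5p4:
  shows "online replenished \<and> polynomial_time replenished \<and>
    (\<forall>d\<ge>2.
       (\<forall>n m P. profile n m P \<longrightarrow> at_most_first_choices d P \<longrightarrow>
          (\<forall>I\<in>intervals (length P). \<forall>S. voter_group n S \<longrightarrow>
             int (card {j\<in>I. \<exists>i\<in>S. first_choice (P ! j) i = replenished P ! j})
               \<ge> \<lfloor>real (card I) * real (card S) / real n\<rfloor> - (int d - 2))) \<and>
       achieves_interval_loss d (int d - 2) replenished) \<and>
    optimal_loss online 2 0 \<and> optimal_loss offline 2 0 \<and>
    optimal_loss online 3 1 \<and> optimal_loss offline 3 1 \<and>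
    (\<exists>n m P. profile n m P \<and> static P \<and> euclidean_1d P \<and> at_most_first_choices 3 P \<and>
       \<not> (\<exists>W. winner_seq m P W \<and>
              (\<forall>I\<in>intervals (length P). fixed_rank_wJR n m P W I))) \<and>
    (\<forall>kind\<in>{online, offline}. \<exists>opt :: nat \<Rightarrow> int.
       (\<forall>d\<ge>2. optimal_loss kind d (opt d)) \<and>
       (\<lambda>d. real_of_int (opt d)) \<in> \<Theta>(\<lambda>d. real d))"
proof (intro conjI)
  have off: "offline replenished" "\<And>F. online F \<Longrightarrow> offline F"
    using online_replenished by (simp_all add: online_def)
  show "\<exists>n m P. profile n m P \<and> static P \<and> euclidean_1d P \<and> at_most_first_choices 3 P \<and>
      \<not> (\<exists>W. winner_seq m P W \<and> (\<forall>I\<in>intervals (length P). fixed_rank_wJR n m P W I))"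
    by (intro exI[of _ 6] exI[of _ 3] exI[of _ pinwheel_profile] conjI pinwheel_profile
        static_pinwheel euclidean_pinwheel at_most_first_choices_pinwheel)
      (use pinwheel_no_fixed_rank_wJR in blast)
  show "optimal_loss online 3 1"
    using online_replenished off(2) by (rule optimal_loss_3)
  show "optimal_loss offline 3 1"
    using off(1) by (rule optimal_loss_3)
  show "\<forall>kind\<in>{online, offline}. \<exists>opt :: nat \<Rightarrow> int.
      (\<forall>d\<ge>2. optimal_loss kind d (opt d)) \<and> (\<lambda>d. real_of_int (opt d)) \<in> \<Theta>(\<lambda>d. real d)"
  proof
    fix kind assume "kind \<in> {online, offline}"
    then have "kind replenished" "\<And>F. kind F \<Longrightarrow> offline F"
      using online_replenished off by auto
    then show "\<exists>opt :: nat \<Rightarrow> int. (\<forall>d\<ge>2. optimal_loss kind d (opt d)) \<and>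
        (\<lambda>d. real_of_int (opt d)) \<in> \<Theta>(\<lambda>d. real d)"
      by (rule optimal_loss_theta)
  qed
  show "\<forall>d\<ge>2.
      (\<forall>n m P. profile n m P \<longrightarrow> at_most_first_choices d P \<longrightarrow>
         (\<forall>I\<in>intervals (length P). \<forall>S. voter_group n S \<longrightarrow>
            int (card {j\<in>I. \<exists>i\<in>S. first_choice (P ! j) i = replenished P ! j})
              \<ge> \<lfloor>real (card I) * real (card S) / real n\<rfloor> - (int d - 2))) \<and>
      achieves_interval_loss d (int d - 2) replenished"
    by (intro allI impI conjI ballI replenished_first_choice_bound replenished_achieves)
  show "online replenished" by (rule online_replenished)
  show "polynomial_time replenished" by (rule polynomial_time_replenished)
  show "optimal_loss online 2 0" using online_replenished by (rule optimal_loss_2)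
  show "optimal_loss offline 2 0" using off(1) by (rule optimal_loss_2)
qed

end
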